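(* Let $E$ be a graph and $w\in E^0$ with $s_E^{-1}(w)=\{f\}$. Let $E_L$ and $E_R$ be formed by performing a balanced in-split of $E$ at $w$, with respect to partitions $\mathcal L_1,\dots,\mathcal L_n$ and $\mathcal R_1,\dots,\mathcal R_n$ of $t_E^{-1}(w)$, respectively. Then the maps $\phi^0\colon E_L^0\to S(E_R)$ and $\phi^1\colon E_L^1\to S(E_R)$ defined by $$\phi^0(v^i)=\begin{cases}(v^i,v^i)& v\neq w\\ (f^i,f^i)& v=w\end{cases},\qquad \phi^1(e^i)=\begin{cases}(e^i,t_{E_R}(e^i))& t_E(e)\neq w\\ (e^if^k,f^j)& t_E(e)=w,\ e\in\mathcal L_j\cap\mathcal R_k\end{cases}$$ yield a regular extended path homomorphism $\phi\colon S(E_L)\to S(E_R)$ that covariantly induces the $*$-homomorphism $\phi_*\colon C^*(E_L)\to C^*(E_R)$ given by $$\phi_*(S_{v^i})=S_{v^i},\qquad \phi_*(S_{e^i})=\begin{cases}S_{e^i}& t_E(e)\ne w\\ S_{e^i}S_{f^k}S_{f^j}^*& t_E(e)=w,\ e\in\mathcal L_j\cap\mathcal R_k\end{cases}$$ for $v^i\in E_L^0$ and $e^i\in E_L^1$.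
   Context: A graph $E=(E^0,E^1,s_E,t_E)$ consists of arbitrary sets of vertices and edges with source and target maps. A vertex $v$ is regular if $s_E^{-1}(v)$ is finite and nonempty; $\mathrm{reg}(E)$ is the set of regular vertices. $\mathrm{FP}(E)$ is the set of finite paths (vertices, of length $0$, and sequences $e_1\ldots e_n$ of edges with $t_E(e_i)=s_E(e_{i+1})$); vertices act as units for concatenation. In-split of $E$ at a regular vertex $w$ with respect to a partition of $t_E^{-1}(w)$ into a finite disjoint union of (possibly empty) sets $\epsilon_1,\dots,\epsilon_n$: the graph $E_I$ with $E_I^0=\{v^1\mid v\in E^0,v\ne w\}\sqcup\{w^1,\dots,w^n\}$, $E_I^1=\{e^1\mid e\in E^1,s_E(e)\neq w\}\sqcup\{e^i\mid s_E(e)=w,1\le i\le n\}$, $s_{E_I}(e^i)=s_E(e)^i$, and $t_{E_I}(e^i)=t_E(e)^1$ if $t_E(e)\ne w$, $t_{E_I}(e^i)=w^j$ if $t_E(e)=w$ and $e\in\epsilon_j$. A balanced in-split of $E$ at $w$ is a pair $E_L,E_R$ of in-splits of $E$ at $w$ with respect to partitions $\mathcal L_1,\dots,\mathcal L_n$ and $\mathcal R_1,\dots,\mathcal R_n$ with the same number $n$ of (possibly empty) sets. Vertices and edges of $E_L$ and $E_R$ are denoted by the same symbols $v^i$, $e^i$, although the targets of edges may differ. $C^*(E)$ is the universal C*-algebra generated by mutually orthogonal projections $S_v$ ($v\in E^0$) and elements $S_e$ ($e\in E^1$) with $S_e^*S_{e'}=\delta_{e,e'}S_{t_E(e)}$,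 $S_{s_E(e)}S_e=S_e$, and $S_v=\sum_{e\in s_E^{-1}(v)}S_eS_e^*$ for $v\in\mathrm{reg}(E)$. For paths, $S_{e_1\ldots e_n}=S_{e_1}\cdots S_{e_n}$; put $S_{(\alpha,\beta)}=S_\alpha S_\beta^*$, $S_0=0$. The graph inverse semigroup is $S(E)=\{(\alpha,\beta)\in \mathrm{FP}(E)^2\mid t_E(\alpha)=t_E(\beta)\}\cup\{0\}$ with $(\alpha,\beta)(\gamma,\delta)=(\alpha\gamma',\delta)$ if $\gamma=\beta\gamma'$, $=(\alpha,\delta\beta')$ if $\beta=\gamma\beta'$, and $=0$ otherwise; $0$ is a zero element. It is an inverse semigroup with $(\alpha,\beta)^*=(\beta,\alpha)$ and natural order $s\le t\iff ss^*t=s$. An extended path homomorphism from $E$ to $F$ is a semigroup homomorphism $\varphi\colon S(E)\to S(F)$ with $\varphi(0)=0$. Maps $\varphi^0\colon E^0\to S(F)$, $\varphi^1\colon E^1\to S(F)$ yield $\varphi$ if $\varphi$ is the (necessarily unique) extended path homomorphism with $\varphi(v,v)=\varphi^0(v)$ and $\varphi(e,t_E(e))=\varphi^1(e)$. $\varphi$ is regular if whenever $u\in\mathrm{reg}(E)$, $0\ne t\in S(F)$ and $t\le\varphi(u,u)$, there exists $e\in s_E^{-1}(u)$ with $t\varphi(e,e)\neq0$. A regular $\varphi$ induces the $*$-homomorphism $\varphi_*\colon C^*(E)\to C^*(F)$, $S_v\mapsto S_{\varphi(v,v)}$, $S_e\mapsto S_{\varphi(e,t_E(e))}$. *)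

theory Defs
  imports
    Complex_Main
    "HOL-Library.Poly_Mapping"
    "HOL-Library.Sublist"
    "HOL-Library.Disjoint_Sets"
    "Graph_Theory.Arc_Walk"
begin

section \<open>Graphs, paths and in-splits\<close>

text \<open>
  A graph is a \<open>pre_digraph\<close> satisfying \<open>wf_digraph\<close>; its vertex and edge sets are
  arbitrary. The source map is \<open>tail\<close> and the target map is \<open>head\<close>, so
  \<open>out_arcs E v\<close> and \<open>in_arcs E v\<close> are the fibres of the source and target maps over \<open>v\<close>.
\<close>

definition reg :: "('v, 'e) pre_digraph \<Rightarrow> 'v set" where
  "reg E = {v \<in> verts E. finite (out_arcs E v) \<and> out_arcs E v \<noteq> {}}"

text \<open>A finite path is stored with its source vertex, so that \<open>(v, [])\<close> is the path \<open>v\<close> of length 0.\<close>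

type_synonym ('v, 'e) path = "'v \<times> 'e list"

definition FP :: "('v, 'e) pre_digraph \<Rightarrow> ('v, 'e) path set" where
  "FP E = {(u, p). \<exists>v. pre_digraph.awalk E u p v}"

definition path_target :: "('v, 'e) pre_digraph \<Rightarrow> ('v, 'e) path \<Rightarrow> 'v" where
  "path_target E \<alpha> = last (pre_digraph.awalk_verts E (fst \<alpha>) (snd \<alpha>))"

definition vpath :: "'v \<Rightarrow> ('v, 'e) path" where
  "vpath v = (v, [])"

definition epath :: "('v, 'e) pre_digraph \<Rightarrow> 'e \<Rightarrow> ('v, 'e) path" where
  "epath E e = (tail E e, [e])"

text \<open>Only meaningful if the target of the first path is the source of the second.\<close>

definition concat_path :: "('v, 'e) path \<Rightarrow> ('v, 'e) path \<Rightarrow> ('v, 'e) path" where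
  "concat_path \<alpha> \<beta> = (fst \<alpha>, snd \<alpha> @ snd \<beta>)"

definition indexed_partition :: "nat \<Rightarrow> (nat \<Rightarrow> 'a set) \<Rightarrow> 'a set \<Rightarrow> bool" where
  "indexed_partition n P A \<longleftrightarrow>
     1 \<le> n \<and> disjoint_family_on P {1..n} \<and> (\<Union>i\<in>{1..n}. P i) = A"

definition block_index :: "nat \<Rightarrow> (nat \<Rightarrow> 'a set) \<Rightarrow> 'a \<Rightarrow> nat" where
  "block_index n P x = (THE j. j \<in> {1..n} \<and> x \<in> P j)"

text \<open>The vertex \<open>v\<^sup>i\<close> is the pair \<open>(v, i)\<close> and the edge \<open>e\<^sup>i\<close> is the pair \<open>(e, i)\<close>.\<close>

definition in_split ::
  "('v, 'e) pre_digraph \<Rightarrow> 'v \<Rightarrow> nat \<Rightarrow> (nat \<Rightarrow> 'e set) \<Rightarrow> ('v \<times> nat, 'e \<times> nat) pre_digraph" where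
  "in_split E w n P =
     \<lparr> verts = {(v, 1) | v. v \<in> verts E \<and> v \<noteq> w} \<union> {(w, i) | i. i \<in> {1..n}},
       arcs = {(e, 1) | e. e \<in> arcs E \<and> tail E e \<noteq> w}
            \<union> {(e, i) | e i. e \<in> arcs E \<and> tail E e = w \<and> i \<in> {1..n}},
       tail = (\<lambda>(e, i). (tail E e, i)),
       head = (\<lambda>(e, i). if head E e \<noteq> w then (head E e, 1) else (w, block_index n P e)) \<rparr>"

definition balanced_in_split ::
  "('v, 'e) pre_digraph \<Rightarrow> 'v \<Rightarrow> nat \<Rightarrow> (nat \<Rightarrow> 'e set) \<Rightarrow> (nat \<Rightarrow> 'e set) \<Rightarrow>
   ('v \<times> nat, 'e \<times> nat) pre_digraph \<Rightarrow> ('v \<times> nat, 'e \<times> nat) pre_digraph \<Rightarrow> bool" where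
  "balanced_in_split E w n L R EL ER \<longleftrightarrow>
     w \<in> reg E \<and>
     indexed_partition n L (in_arcs E w) \<and> indexed_partition n R (in_arcs E w) \<and>
     EL = in_split E w n L \<and> ER = in_split E w n R"

section \<open>The graph inverse semigroup and extended path homomorphisms\<close>

text \<open>The zero element is \<open>None\<close>.\<close>

type_synonym ('v, 'e) gis = "(('v, 'e) path \<times> ('v, 'e) path) option"

definition gis :: "('v, 'e) pre_digraph \<Rightarrow> ('v, 'e) gis set" where
  "gis E = {Some (\<alpha>, \<beta>) | \<alpha> \<beta>. \<alpha> \<in> FP E \<and> \<beta> \<in> FP E \<and> path_target E \<alpha> = path_target E \<beta>} \<union> {None}"

text \<open>
  For paths of one graph, \<open>\<gamma> = \<beta>\<gamma>'\<close> for some path \<open>\<gamma>'\<close> iff the sources of \<open>\<beta>\<close> and \<open>\<gamma>\<close> agree and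
  the edge list of \<open>\<beta>\<close> is a prefix of that of \<open>\<gamma>\<close>; what \<open>drop\<close> returns is the edge list of \<open>\<gamma>'\<close>.
\<close>

fun gis_mult :: "('v, 'e) gis \<Rightarrow> ('v, 'e) gis \<Rightarrow> ('v, 'e) gis" where
  "gis_mult (Some ((a, p), (b, q))) (Some ((c, r), (d, s))) =
     (if b = c \<and> prefix q r then Some ((a, p @ drop (length q) r), (d, s))
      else if b = c \<and> prefix r q then Some ((a, p), (d, s @ drop (length r) q))
      else None)"
| "gis_mult None _ = None"
| "gis_mult _ None = None"

definition gis_star :: "('v, 'e) gis \<Rightarrow> ('v, 'e) gis" where
  "gis_star s = map_option prod.swap s"

definition gis_le :: "('v, 'e) gis \<Rightarrow> ('v, 'e) gis \<Rightarrow> bool" where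
  "gis_le s t \<longleftrightarrow> gis_mult (gis_mult s (gis_star s)) t = s"

definition extended_path_hom ::
  "('v, 'e) pre_digraph \<Rightarrow> ('x, 'y) pre_digraph \<Rightarrow> (('v, 'e) gis \<Rightarrow> ('x, 'y) gis) \<Rightarrow> bool" where
  "extended_path_hom E F \<phi> \<longleftrightarrow>
     (\<forall>s\<in>gis E. \<phi> s \<in> gis F) \<and>
     (\<forall>s\<in>gis E. \<forall>t\<in>gis E. \<phi> (gis_mult s t) = gis_mult (\<phi> s) (\<phi> t)) \<and>
     \<phi> None = None"

definition has_generator_values ::
  "('v, 'e) pre_digraph \<Rightarrow> ('v \<Rightarrow> ('x, 'y) gis) \<Rightarrow> ('e \<Rightarrow> ('x, 'y) gis) \<Rightarrow>
   (('v, 'e) gis \<Rightarrow> ('x, 'y) gis) \<Rightarrow> bool" where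
  "has_generator_values E \<phi>0 \<phi>1 \<phi> \<longleftrightarrow>
     (\<forall>v\<in>verts E. \<phi> (Some (vpath v, vpath v)) = \<phi>0 v) \<and>
     (\<forall>e\<in>arcs E. \<phi> (Some (epath E e, vpath (head E e))) = \<phi>1 e)"

text \<open>Uniqueness is up to the (irrelevant) values outside the graph inverse semigroup.\<close>

definition yields ::
  "('v, 'e) pre_digraph \<Rightarrow> ('x, 'y) pre_digraph \<Rightarrow> ('v \<Rightarrow> ('x, 'y) gis) \<Rightarrow> ('e \<Rightarrow> ('x, 'y) gis) \<Rightarrow>
   (('v, 'e) gis \<Rightarrow> ('x, 'y) gis) \<Rightarrow> bool" where
  "yields E F \<phi>0 \<phi>1 \<phi> \<longleftrightarrow>
     extended_path_hom E F \<phi> \<and> has_generator_values E \<phi>0 \<phi>1 \<phi> \<and>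
     (\<forall>\<psi>. extended_path_hom E F \<psi> \<and> has_generator_values E \<phi>0 \<phi>1 \<psi> \<longrightarrow> (\<forall>s\<in>gis E. \<psi> s = \<phi> s))"

definition regular_hom ::
  "('v, 'e) pre_digraph \<Rightarrow> ('x, 'y) pre_digraph \<Rightarrow> (('v, 'e) gis \<Rightarrow> ('x, 'y) gis) \<Rightarrow> bool" where
  "regular_hom E F \<phi> \<longleftrightarrow>
     (\<forall>u\<in>reg E. \<forall>t\<in>gis F. t \<noteq> None \<and> gis_le t (\<phi> (Some (vpath u, vpath u))) \<longrightarrow>
        (\<exists>e\<in>out_arcs E u. gis_mult t (\<phi> (Some (epath E e, epath E e))) \<noteq> None))"

section \<open>The universal C*-algebra of a graph\<close>

text \<open>
  The universal C*-algebra on generators and relations is constructed in the standard way: take the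
  free (non-unital) complex *-algebra on the generators, equip it with the largest C*-seminorm that
  vanishes on the relators, and pass to the Hausdorff completion.

  The free *-algebra consists of the finitely supported functions on words in the formal symbols
  \<open>(g, False)\<close> for a generator \<open>g\<close> and \<open>(g, True)\<close> for its adjoint, with the convolution product of
  \<open>Poly_Mapping\<close>. The wrapper type only serves to make concatenation the monoid addition that this
  product uses.
\<close>

datatype 'g star_word = Star_Word (letters: "('g \<times> bool) list")

instantiation star_word :: (type) monoid_add
begin

definition zero_star_word :: "'a star_word" where
  "0 = Star_Word []"

definition plus_star_word :: "'a star_word \<Rightarrow> 'a star_word \<Rightarrow> 'a star_word" where
  "u + v = Star_Word (letters u @ letters v)"

instance
  by standard (simp_all add: zero_star_word_def plus_star_word_def)

end

definition word_adj :: "'g star_word \<Rightarrow> 'g star_word" where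
  "word_adj u = Star_Word (rev (map (\<lambda>(g, b). (g, \<not> b)) (letters u)))"

type_synonym 'g free_alg = "'g star_word \<Rightarrow>\<^sub>0 complex"

definition free_adj :: "'g free_alg \<Rightarrow> 'g free_alg" where
  "free_adj x = Poly_Mapping.map cnj (Poly_Mapping.map_key word_adj x)"

definition free_scale :: "complex \<Rightarrow> 'g free_alg \<Rightarrow> 'g free_alg" where
  "free_scale c x = Poly_Mapping.map (\<lambda>z. c * z) x"

definition free_gen :: "'g \<Rightarrow> 'g free_alg" where
  "free_gen g = Poly_Mapping.single (Star_Word [(g, False)]) 1"

text \<open>The empty word is excluded: the free *-algebra on the set \<open>G\<close> of generators has no unit.\<close>

definition free_carrier :: "'g set \<Rightarrow> 'g free_alg set" where
  "free_carrier G = {x. \<forall>u\<in>Poly_Mapping.keys x. letters u \<noteq> [] \<and> fst ` set (letters u) \<subseteq> G}"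

definition cstar_seminorm :: "'g set \<Rightarrow> ('g free_alg \<Rightarrow> real) \<Rightarrow> bool" where
  "cstar_seminorm G p \<longleftrightarrow>
     (\<forall>x\<in>free_carrier G. 0 \<le> p x) \<and>
     (\<forall>x\<in>free_carrier G. \<forall>c. p (free_scale c x) = cmod c * p x) \<and>
     (\<forall>x\<in>free_carrier G. \<forall>y\<in>free_carrier G. p (x + y) \<le> p x + p y) \<and>
     (\<forall>x\<in>free_carrier G. \<forall>y\<in>free_carrier G. p (x * y) \<le> p x * p y) \<and>
     (\<forall>x\<in>free_carrier G. p (free_adj x) = p x) \<and>
     (\<forall>x\<in>free_carrier G. p (free_adj x * x) = (p x)\<^sup>2)"

text \<open>
  The supremum is over a set containing the zero seminorm. It is a genuine (bounded) supremum
  whenever the relations bound the generators, as they do for graphs, where the generators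
  are projections and partial isometries.
\<close>

definition universal_norm :: "'g set \<Rightarrow> 'g free_alg set \<Rightarrow> 'g free_alg \<Rightarrow> real" where
  "universal_norm G Rel x = Sup {p x | p. cstar_seminorm G p \<and> (\<forall>r\<in>Rel. p r = 0)}"

definition cauchy_seqs :: "'g set \<Rightarrow> 'g free_alg set \<Rightarrow> (nat \<Rightarrow> 'g free_alg) set" where
  "cauchy_seqs G Rel = {x. (\<forall>n. x n \<in> free_carrier G) \<and>
     (\<forall>\<epsilon>>0. \<exists>M. \<forall>m\<ge>M. \<forall>n\<ge>M. universal_norm G Rel (x m - x n) < \<epsilon>)}"

definition null_rel :: "'g set \<Rightarrow> 'g free_alg set \<Rightarrow> (nat \<Rightarrow> 'g free_alg) rel" where
  "null_rel G Rel = {(x, y). x \<in> cauchy_seqs G Rel \<and> y \<in> cauchy_seqs G Rel \<and>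
     (\<lambda>n. universal_norm G Rel (x n - y n)) \<longlonglongrightarrow> 0}"

record 'a cstar_alg =
  ccarrier :: "'a set"
  czero :: 'a
  cadd :: "'a \<Rightarrow> 'a \<Rightarrow> 'a"
  cscale :: "complex \<Rightarrow> 'a \<Rightarrow> 'a"
  cmult :: "'a \<Rightarrow> 'a \<Rightarrow> 'a"
  cadj :: "'a \<Rightarrow> 'a"
  cnorm :: "'a \<Rightarrow> real"

definition universal_cstar ::
  "'g set \<Rightarrow> 'g free_alg set \<Rightarrow> (nat \<Rightarrow> 'g free_alg) set cstar_alg" where
  "universal_cstar G Rel = (let cls = (\<lambda>x. null_rel G Rel `` {x}) in
     \<lparr> ccarrier = cauchy_seqs G Rel // null_rel G Rel,
       czero = cls (\<lambda>_. 0),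
       cadd = (\<lambda>X Y. \<Union>x\<in>X. \<Union>y\<in>Y. cls (\<lambda>n. x n + y n)),
       cscale = (\<lambda>c X. \<Union>x\<in>X. cls (\<lambda>n. free_scale c (x n))),
       cmult = (\<lambda>X Y. \<Union>x\<in>X. \<Union>y\<in>Y. cls (\<lambda>n. x n * y n)),
       cadj = (\<lambda>X. \<Union>x\<in>X. cls (\<lambda>n. free_adj (x n))),
       cnorm = (\<lambda>X. THE r. \<forall>x\<in>X. (\<lambda>n. universal_norm G Rel (x n)) \<longlonglongrightarrow> r) \<rparr>)"

definition universal_gen :: "'g set \<Rightarrow> 'g free_alg set \<Rightarrow> 'g \<Rightarrow> (nat \<Rightarrow> 'g free_alg) set" where
  "universal_gen G Rel g = null_rel G Rel `` {\<lambda>_. free_gen g}"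

text \<open>*-homomorphisms between C*-algebras; continuity is automatic and not part of the definition.\<close>

definition star_hom :: "'a cstar_alg \<Rightarrow> 'b cstar_alg \<Rightarrow> ('a \<Rightarrow> 'b) \<Rightarrow> bool" where
  "star_hom A B h \<longleftrightarrow>
     (\<forall>x\<in>ccarrier A. h x \<in> ccarrier B) \<and>
     (\<forall>x\<in>ccarrier A. \<forall>y\<in>ccarrier A. h (cadd A x y) = cadd B (h x) (h y)) \<and>
     (\<forall>x\<in>ccarrier A. \<forall>c. h (cscale A c x) = cscale B c (h x)) \<and>
     (\<forall>x\<in>ccarrier A. \<forall>y\<in>ccarrier A. h (cmult A x y) = cmult B (h x) (h y)) \<and>
     (\<forall>x\<in>ccarrier A. h (cadj A x) = cadj B (h x))"

definition graph_gens :: "('v, 'e) pre_digraph \<Rightarrow> ('v + 'e) set" where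
  "graph_gens E = Inl ` verts E \<union> Inr ` arcs E"

text \<open>A relation \<open>a = b\<close> is encoded by the relator \<open>a - b\<close>.\<close>

definition graph_relators :: "('v, 'e) pre_digraph \<Rightarrow> ('v + 'e) free_alg set" where
  "graph_relators E = (let P = (\<lambda>v. free_gen (Inl v)); S = (\<lambda>e. free_gen (Inr e)) in
     {free_adj (P v) - P v | v. v \<in> verts E} \<union>
     {P v * P v - P v | v. v \<in> verts E} \<union>
     {P u * P v | u v. u \<in> verts E \<and> v \<in> verts E \<and> u \<noteq> v} \<union>
     {free_adj (S e) * S e - P (head E e) | e. e \<in> arcs E} \<union>
     {free_adj (S e) * S e' | e e'. e \<in> arcs E \<and> e' \<in> arcs E \<and> e \<noteq> e'} \<union>
     {P (tail E e) * S e - S e | e. e \<in> arcs E} \<union>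
     {P v - (\<Sum>e\<in>out_arcs E v. S e * free_adj (S e)) | v. v \<in> reg E})"

definition graph_cstar ::
  "('v, 'e) pre_digraph \<Rightarrow> (nat \<Rightarrow> ('v + 'e) free_alg) set cstar_alg" where
  "graph_cstar E = universal_cstar (graph_gens E) (graph_relators E)"

definition S_vertex :: "('v, 'e) pre_digraph \<Rightarrow> 'v \<Rightarrow> (nat \<Rightarrow> ('v + 'e) free_alg) set" where
  "S_vertex E v = universal_gen (graph_gens E) (graph_relators E) (Inl v)"

definition S_edge :: "('v, 'e) pre_digraph \<Rightarrow> 'e \<Rightarrow> (nat \<Rightarrow> ('v + 'e) free_alg) set" where
  "S_edge E e = universal_gen (graph_gens E) (graph_relators E) (Inr e)"

fun S_path :: "('v, 'e) pre_digraph \<Rightarrow> ('v, 'e) path \<Rightarrow> (nat \<Rightarrow> ('v + 'e) free_alg) set" where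
  "S_path E (v, []) = S_vertex E v"
| "S_path E (v, [e]) = S_edge E e"
| "S_path E (v, e # e' # es) = cmult (graph_cstar E) (S_edge E e) (S_path E (head E e, e' # es))"

fun S_gis :: "('v, 'e) pre_digraph \<Rightarrow> ('v, 'e) gis \<Rightarrow> (nat \<Rightarrow> ('v + 'e) free_alg) set" where
  "S_gis E None = czero (graph_cstar E)"
| "S_gis E (Some (\<alpha>, \<beta>)) =
     cmult (graph_cstar E) (S_path E \<alpha>) (cadj (graph_cstar E) (S_path E \<beta>))"

definition induces ::
  "('v, 'e) pre_digraph \<Rightarrow> ('x, 'y) pre_digraph \<Rightarrow> (('v, 'e) gis \<Rightarrow> ('x, 'y) gis) \<Rightarrow>
   ((nat \<Rightarrow> ('v + 'e) free_alg) set \<Rightarrow> (nat \<Rightarrow> ('x + 'y) free_alg) set) \<Rightarrow> bool" where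
  "induces E F \<phi> \<Phi> \<longleftrightarrow>
     star_hom (graph_cstar E) (graph_cstar F) \<Phi> \<and>
     (\<forall>v\<in>verts E. \<Phi> (S_vertex E v) = S_gis F (\<phi> (Some (vpath v, vpath v)))) \<and>
     (\<forall>e\<in>arcs E. \<Phi> (S_edge E e) = S_gis F (\<phi> (Some (epath E e, vpath (head E e)))))"

section \<open>The maps of the balanced in-split\<close>

text \<open>Here \<open>f\<close> is the only edge with source \<open>w\<close> and \<open>ER\<close> is the in-split with respect to \<open>R\<close>.\<close>

definition split_vertex_map ::
  "'v \<Rightarrow> 'e \<Rightarrow> ('v \<times> nat, 'e \<times> nat) pre_digraph \<Rightarrow> 'v \<times> nat \<Rightarrow> ('v \<times> nat, 'e \<times> nat) gis" where
  "split_vertex_map w f ER = (\<lambda>(v, i).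
     if v \<noteq> w then Some (vpath (v, i), vpath (v, i))
     else Some (epath ER (f, i), epath ER (f, i)))"

definition split_edge_map ::
  "('v, 'e) pre_digraph \<Rightarrow> 'v \<Rightarrow> 'e \<Rightarrow> nat \<Rightarrow> (nat \<Rightarrow> 'e set) \<Rightarrow> (nat \<Rightarrow> 'e set) \<Rightarrow>
   ('v \<times> nat, 'e \<times> nat) pre_digraph \<Rightarrow> 'e \<times> nat \<Rightarrow> ('v \<times> nat, 'e \<times> nat) gis" where
  "split_edge_map E w f n L R ER = (\<lambda>(e, i).
     if head E e \<noteq> w then Some (epath ER (e, i), vpath (head ER (e, i)))
     else let j = block_index n L e; k = block_index n R e in
       Some (concat_path (epath ER (e, i)) (epath ER (f, k)), epath ER (f, j)))"

end

theory Submission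
  imports Defs
begin

text \<open>
  In the in-split graphs every copy \<open>w\<^sup>i\<close> of \<open>w\<close> emits only \<open>f\<^sup>i\<close>, so the projection of \<open>w\<^sup>i\<close> is the range projection of
  \<open>f\<^sup>i\<close>, and all \<open>f\<^sup>i\<close> have the same target. Hence \<open>f\<^sup>k\<close> followed by the inverse of \<open>f\<^sup>j\<close> moves from \<open>w\<^sup>k\<close> to \<open>w\<^sup>j\<close>
  and corrects the target of an edge of the second in-split to the one it has in the first.

  On the semigroup level, values on vertices and edges extend to an extended path homomorphism as soon
  as they satisfy the relations of a Cuntz-Krieger family other than the summation relation; it is unique
  because homomorphisms of inverse semigroups preserve inverses. Regularity holds because a path
  continuing an edge into \<open>w\<^sup>k\<close> can only continue along \<open>f\<^sup>k\<close>.

  On the C*-level, the images of the generators are words in the free *-algebra that satisfy all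
  relations modulo the universal seminorm. The induced map of free *-algebras is therefore contractive
  and passes to the completions.
\<close>

section \<open>The free *-algebra\<close>

text \<open>Equations between images hold exactly in the semigroup but only modulo a seminorm in the
  algebra, and this separates the two halves. In the semigroup \<open>(f\<^sup>j, f\<^sup>j)\<close>
  lies strictly below \<open>(w\<^sup>j, w\<^sup>j)\<close>. An edge into \<open>w\<^sup>j\<close>
  of the first in-split has a value ending in the inverse of \<open>f\<^sup>j\<close>, so its source
  projection is \<open>(f\<^sup>j, f\<^sup>j)\<close>, and this has to be the value at
  \<open>w\<^sup>j\<close>. It still acts as a left unit on the values of edges leaving
  \<open>w\<^sup>j\<close>, because these values begin with \<open>f\<^sup>j\<close>.

  In the algebra the summation relation identifies the two projections. There the vertex generators
  are kept fixed, only the edges into \<open>w\<close> are changed, and the two descriptions are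
  compared at the end.

  The other obstacle is that the universal norm is a supremum over seminorms on a free algebra. Its
  finiteness, and relations such as \<open>S\<^sub>e P = S\<^sub>e\<close> that are not relators,
  have to be extracted from the C*-identity for an arbitrary admissible seminorm.\<close>

lemma poly_mapping_sum_singles:
  "x = (\<Sum>u\<in>Poly_Mapping.keys x. Poly_Mapping.single u (Poly_Mapping.lookup x u))"
  by (rule poly_mapping_eqI)
     (auto simp: lookup_sum lookup_single when_def in_keys_iff)

text \<open>Reduces additive and bilinear identities to scalar multiples of single words. The zero
  element is covered by \<open>single\<close> with coefficient 0.\<close>

lemma poly_mapping_single_add_induct [case_names single add]:
  fixes x :: "'a \<Rightarrow>\<^sub>0 'b :: comm_monoid_add"
  assumes single: "\<And>u c. P (Poly_Mapping.single u c)"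
    and add: "\<And>x y. P x \<Longrightarrow> P y \<Longrightarrow> P (x + y)"
  shows "P x"
proof -
  have "P (\<Sum>u\<in>A. Poly_Mapping.single u (Poly_Mapping.lookup x u))" if "finite A" for A
    using that
  proof (induction A)
    case empty
    show ?case using single[of _ 0] by simp
  qed (simp add: single add)
  then show ?thesis
    by (subst poly_mapping_sum_singles) simp
qed

lemma letters_zero [simp]: "letters 0 = []"
  and letters_plus [simp]: "letters (u + v) = letters u @ letters v"
  by (simp_all add: zero_star_word_def plus_star_word_def)

lemma word_adj_word_adj [simp]: "word_adj (word_adj u) = u"
  by (cases u) (simp add: word_adj_def rev_map o_def case_prod_unfold)

text \<open>\<open>map_key\<close> is composition with the key map when that map is injective; this
  gives the coefficient formula for \<open>free_adj\<close>.\<close>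

lemma inj_word_adj: "inj word_adj"
  by (metis injI word_adj_word_adj)

lemma word_adj_plus: "word_adj (u + v) = word_adj v + word_adj u"
  by (simp add: word_adj_def plus_star_word_def)

lemma letters_word_adj: "letters (word_adj u) = rev (map (\<lambda>(g, b). (g, \<not> b)) (letters u))"
  by (simp add: word_adj_def)

lemma lookup_free_adj [simp]:
  "Poly_Mapping.lookup (free_adj x) u = cnj (Poly_Mapping.lookup x (word_adj u))"
  unfolding free_adj_def
  by (simp add: Poly_Mapping.map.rep_eq map_key.rep_eq inj_word_adj when_def)

lemma free_adj_zero [simp]: "free_adj 0 = 0"
  and free_adj_add: "free_adj (x + y) = free_adj x + free_adj y"
  and free_adj_diff: "free_adj (x - y) = free_adj x - free_adj y"
  and free_adj_free_adj [simp]: "free_adj (free_adj x) = x"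
  by (rule poly_mapping_eqI; simp add: lookup_add lookup_minus)+

lemma free_adj_single: "free_adj (Poly_Mapping.single u c) = Poly_Mapping.single (word_adj u) (cnj c)"
  by (rule poly_mapping_eqI) (metis lookup_free_adj lookup_single_eq lookup_single_not_eq word_adj_word_adj complex_cnj_zero)

lemma free_adj_mult: "free_adj (x * y) = free_adj y * free_adj x"
proof (induction x rule: poly_mapping_single_add_induct)
  case (single u c)
  show ?case
    by (induction y rule: poly_mapping_single_add_induct)
       (simp_all add: mult_single free_adj_single word_adj_plus free_adj_add algebra_simps)
qed (simp add: free_adj_add algebra_simps)

text \<open>The empty word is the unit of the ambient monoid algebra, although
  \<open>free_carrier\<close> excludes it. Scaling thus becomes multiplication by a central element
  and follows the ring laws.\<close>

lemma free_scale_conv_mult: "free_scale c x = Poly_Mapping.single 0 c * x"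
  unfolding free_scale_def using mult_map_scale_conv_mult[of c x] by simp

lemma single_zero_commute:
  "Poly_Mapping.single 0 c * x = x * Poly_Mapping.single 0 (c :: 'b :: comm_semiring_1)"
  by (induction x rule: poly_mapping_single_add_induct) (simp_all add: mult_single algebra_simps)

lemma lookup_free_scale [simp]: "Poly_Mapping.lookup (free_scale c x) u = c * Poly_Mapping.lookup x u"
  by (simp add: free_scale_def Poly_Mapping.map.rep_eq when_def)

lemma free_scale_single: "free_scale c (Poly_Mapping.single u d) = Poly_Mapping.single u (c * d)"
  by (simp add: free_scale_conv_mult mult_single)

lemma free_scale_add: "free_scale c (x + y) = free_scale c x + free_scale c y"
  and free_scale_diff: "free_scale c (x - y) = free_scale c x - free_scale c y"
  and free_scale_add_left: "free_scale (c + d) x = free_scale c x + free_scale d x"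
  and free_scale_scale: "free_scale c (free_scale d x) = free_scale (c * d) x"
  and free_scale_one [simp]: "free_scale 1 x = x"
  and free_scale_zero_left [simp]: "free_scale 0 x = 0"
  and free_scale_zero [simp]: "free_scale c 0 = 0"
  and free_scale_minus_one: "free_scale (-1) x = - x"
  by (rule poly_mapping_eqI; simp add: lookup_add lookup_minus algebra_simps)+

lemma free_adj_scale: "free_adj (free_scale c x) = free_scale (cnj c) (free_adj x)"
  by (rule poly_mapping_eqI) simp

lemma free_scale_mult_left: "free_scale c x * y = free_scale c (x * y)"
  by (simp add: free_scale_conv_mult mult.assoc)

lemma free_scale_mult_right: "x * free_scale c y = free_scale c (x * y)"
  unfolding free_scale_conv_mult by (metis mult.assoc single_zero_commute)

lemma free_carrier_zero [simp]: "0 \<in> free_carrier G"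
  by (simp add: free_carrier_def)

lemma free_carrier_add: "x \<in> free_carrier G \<Longrightarrow> y \<in> free_carrier G \<Longrightarrow> x + y \<in> free_carrier G"
  using keys_add[of x y] by (auto simp: free_carrier_def)

lemma free_carrier_scale: "x \<in> free_carrier G \<Longrightarrow> free_scale c x \<in> free_carrier G"
  by (auto simp: free_carrier_def in_keys_iff)

lemma free_carrier_uminus: "x \<in> free_carrier G \<Longrightarrow> - x \<in> free_carrier G"
  by (metis free_carrier_scale free_scale_minus_one)

lemma free_carrier_diff: "x \<in> free_carrier G \<Longrightarrow> y \<in> free_carrier G \<Longrightarrow> x - y \<in> free_carrier G"
  using free_carrier_add[OF _ free_carrier_uminus] by fastforce

lemma free_carrier_mult: "x \<in> free_carrier G \<Longrightarrow> y \<in> free_carrier G \<Longrightarrow> x * y \<in> free_carrier G"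
  using keys_mult[of x y] by (fastforce simp: free_carrier_def)

lemma free_carrier_adj:
  assumes "x \<in> free_carrier G" shows "free_adj x \<in> free_carrier G"
  unfolding free_carrier_def
proof (intro CollectI ballI)
  fix u assume "u \<in> Poly_Mapping.keys (free_adj x)"
  then have "word_adj u \<in> Poly_Mapping.keys x"
    by (auto simp: in_keys_iff)
  then have "letters (word_adj u) \<noteq> [] \<and> fst ` set (letters (word_adj u)) \<subseteq> G"
    using assms by (auto simp: free_carrier_def)
  then show "letters u \<noteq> [] \<and> fst ` set (letters u) \<subseteq> G"
    by (auto simp: letters_word_adj image_image case_prod_unfold)
qed

lemma free_carrier_sum: "(\<And>i. i \<in> A \<Longrightarrow> h i \<in> free_carrier G) \<Longrightarrow> sum h A \<in> free_carrier G"
  by (induction A rule: infinite_finite_induct) (simp_all add: free_carrier_add)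

lemma free_carrier_gen: "g \<in> G \<Longrightarrow> free_gen g \<in> free_carrier G"
  by (simp add: free_carrier_def free_gen_def)

lemmas free_carrier_intros = free_carrier_zero free_carrier_add free_carrier_scale free_carrier_diff
  free_carrier_mult free_carrier_adj free_carrier_sum free_carrier_gen free_carrier_uminus

section \<open>Universal property of the free *-algebra\<close>

definition letter_value :: "('g \<Rightarrow> 'h free_alg) \<Rightarrow> 'g \<times> bool \<Rightarrow> 'h free_alg" where
  "letter_value a = (\<lambda>(g, b). if b then free_adj (a g) else a g)"

text \<open>The empty word has value 1, so the linear extension is multiplicative on the whole type
  and not only on \<open>free_carrier\<close>.\<close>

definition word_value :: "('g \<Rightarrow> 'h free_alg) \<Rightarrow> 'g star_word \<Rightarrow> 'h free_alg" where
  "word_value a u = prod_list (map (letter_value a) (letters u))"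

definition free_extend :: "('g \<Rightarrow> 'h free_alg) \<Rightarrow> 'g free_alg \<Rightarrow> 'h free_alg" where
  "free_extend a x =
     (\<Sum>u\<in>Poly_Mapping.keys x. free_scale (Poly_Mapping.lookup x u) (word_value a u))"

lemma word_value_plus: "word_value a (u + v) = word_value a u * word_value a v"
  by (simp add: word_value_def)

lemma free_adj_one [simp]: "free_adj 1 = 1"
  using free_adj_single[of 0 1] by (simp add: word_adj_def zero_star_word_def flip: single_one)

lemma word_value_adj: "word_value a (word_adj u) = free_adj (word_value a u)"
proof -
  have "prod_list (map (letter_value a) (rev (map (\<lambda>(g, b). (g, \<not> b)) ls)))
      = free_adj (prod_list (map (letter_value a) ls))" for ls
    by (induction ls) (auto simp: free_adj_mult letter_value_def)
  then show ?thesis by (simp add: word_value_def letters_word_adj)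
qed

text \<open>Cancellation can make the support of a sum smaller than the union of the supports; a
  common finite index set avoids tracking it.\<close>

lemma free_extend_superset:
  assumes "finite A" "Poly_Mapping.keys x \<subseteq> A"
  shows "free_extend a x = (\<Sum>u\<in>A. free_scale (Poly_Mapping.lookup x u) (word_value a u))"
  unfolding free_extend_def using assms
  by (intro sum.mono_neutral_left) (auto simp: in_keys_iff)

lemma free_extend_zero [simp]: "free_extend a 0 = 0"
  by (simp add: free_extend_def)

lemma free_extend_add: "free_extend a (x + y) = free_extend a x + free_extend a y"
proof -
  let ?A = "Poly_Mapping.keys x \<union> Poly_Mapping.keys y"
  note * = free_extend_superset[of ?A]
  show ?thesis
    using keys_add[of x y]
    by (simp add: * lookup_add free_scale_add_left sum.distrib)
qed

lemma free_extend_single: "free_extend a (Poly_Mapping.single u c) = free_scale c (word_value a u)"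
  by (simp add: free_extend_def)

lemma free_extend_scale: "free_extend a (free_scale c x) = free_scale c (free_extend a x)"
  by (induction x rule: poly_mapping_single_add_induct)
     (simp_all add: free_extend_add free_scale_add free_extend_single free_scale_single free_scale_scale)

lemma free_extend_diff: "free_extend a (x - y) = free_extend a x - free_extend a y"
  using free_extend_add[of a x "- y"] free_extend_scale[of a "-1" y]
  by (simp add: free_scale_minus_one)

lemma free_extend_mult: "free_extend a (x * y) = free_extend a x * free_extend a y"
proof (induction x rule: poly_mapping_single_add_induct)
  case (single u c)
  show ?case
    by (induction y rule: poly_mapping_single_add_induct)
       (simp_all add: mult_single free_extend_single word_value_plus free_extend_add distrib_left
          free_scale_mult_left free_scale_mult_right free_scale_scale mult.commute)
qed (simp add: free_extend_add algebra_simps)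

lemma free_extend_adj: "free_extend a (free_adj x) = free_adj (free_extend a x)"
  by (induction x rule: poly_mapping_single_add_induct)
     (simp_all add: free_adj_single free_extend_single free_adj_add free_extend_add free_adj_scale
        word_value_adj)

lemma free_extend_sum: "free_extend a (sum h A) = (\<Sum>i\<in>A. free_extend a (h i))"
  by (induction A rule: infinite_finite_induct) (simp_all add: free_extend_add)

lemma free_extend_gen [simp]: "free_extend a (free_gen g) = a g"
  by (simp add: free_gen_def free_extend_single word_value_def letter_value_def)

text \<open>The carrier has no unit, so it is closed only under products of nonempty lists; this is
  why the induction starts at singletons.\<close>

lemma free_extend_carrier:
  assumes "\<And>g. g \<in> G \<Longrightarrow> a g \<in> free_carrier H" and "x \<in> free_carrier G"
  shows "free_extend a x \<in> free_carrier H"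
proof -
  have "prod_list (map (letter_value a) ls) \<in> free_carrier H"
    if "ls \<noteq> []" "fst ` set ls \<subseteq> G" for ls
    using that
    by (induction ls rule: list_nonempty_induct)
       (auto simp: letter_value_def assms(1) free_carrier_adj free_carrier_mult)
  then show ?thesis
    using assms(2) unfolding free_extend_def word_value_def
    by (intro free_carrier_sum free_carrier_scale) (auto simp: free_carrier_def)
qed

section \<open>C*-seminorms and the universal norm\<close>

locale free_cstar_seminorm =
  fixes G :: "'g set" and p :: "'g free_alg \<Rightarrow> real"
  assumes cstar_seminorm: "cstar_seminorm G p"
begin

lemma nonneg: "x \<in> free_carrier G \<Longrightarrow> 0 \<le> p x"
  and scale: "x \<in> free_carrier G \<Longrightarrow> p (free_scale c x) = cmod c * p x"
  and triangle: "x \<in> free_carrier G \<Longrightarrow> y \<in> free_carrier G \<Longrightarrow> p (x + y) \<le> p x + p y"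
  and submult: "x \<in> free_carrier G \<Longrightarrow> y \<in> free_carrier G \<Longrightarrow> p (x * y) \<le> p x * p y"
  and adj: "x \<in> free_carrier G \<Longrightarrow> p (free_adj x) = p x"
  and cstar: "x \<in> free_carrier G \<Longrightarrow> p (free_adj x * x) = (p x)\<^sup>2"
  using cstar_seminorm unfolding cstar_seminorm_def by blast+

lemma zero [simp]: "p 0 = 0"
  using scale[of 0 0] by simp

lemma uminus: "x \<in> free_carrier G \<Longrightarrow> p (- x) = p x"
  using scale[of x "-1"] by (simp add: free_scale_minus_one)

lemma minus_commute: "x \<in> free_carrier G \<Longrightarrow> y \<in> free_carrier G \<Longrightarrow> p (x - y) = p (y - x)"
  using uminus[of "x - y"] by (simp add: free_carrier_diff)

lemma triangle_sub:
  assumes "x \<in> free_carrier G" "y \<in> free_carrier G" "z \<in> free_carrier G"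
  shows "p (x - z) \<le> p (x - y) + p (y - z)"
  using triangle[of "x - y" "y - z"] assms by (simp add: free_carrier_diff)

lemma abs_diff_le:
  assumes "x \<in> free_carrier G" "y \<in> free_carrier G"
  shows "\<bar>p x - p y\<bar> \<le> p (x - y)"
  using triangle[of "x - y" y] triangle[of "y - x" x] minus_commute[of x y] assms
  by (simp add: free_carrier_diff)

lemma mult_diff_le:
  assumes "x \<in> free_carrier G" "y \<in> free_carrier G" "x' \<in> free_carrier G" "y' \<in> free_carrier G"
  shows "p (x * y - x' * y') \<le> p x * p (y - y') + p (x - x') * p y'"
proof -
  have "x * y - x' * y' = x * (y - y') + (x - x') * y'"
    by (simp add: algebra_simps)
  then have "p (x * y - x' * y') \<le> p (x * (y - y')) + p ((x - x') * y')"
    using triangle[of "x * (y - y')" "(x - x') * y'"] assms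
    by (simp add: free_carrier_intros)
  also have "\<dots> \<le> p x * p (y - y') + p (x - x') * p y'"
    using assms by (intro add_mono submult) (simp_all add: free_carrier_intros)
  finally show ?thesis .
qed

lemma sum_le:
  assumes "\<And>i. i \<in> A \<Longrightarrow> h i \<in> free_carrier G"
  shows "p (sum h A) \<le> (\<Sum>i\<in>A. p (h i))"
  using assms
proof (induction A rule: infinite_finite_induct)
  case (insert i A)
  then show ?case
    using triangle[of "h i" "sum h A"] by (fastforce simp: free_carrier_sum)
qed simp_all

text \<open>Congruence modulo the kernel of the seminorm. Membership in the carrier is built in so
  that transitivity and products need no side conditions.\<close>

definition null_eq :: "'g free_alg \<Rightarrow> 'g free_alg \<Rightarrow> bool" (infix "\<approx>" 50) where
  "x \<approx> y \<longleftrightarrow> x \<in> free_carrier G \<and> y \<in> free_carrier G \<and> p (x - y) = 0"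

lemma null_eq_refl: "x \<in> free_carrier G \<Longrightarrow> x \<approx> x"
  by (simp add: null_eq_def)

lemma null_eq_sym: "x \<approx> y \<Longrightarrow> y \<approx> x"
  using minus_commute by (auto simp: null_eq_def)

lemma null_eq_trans [trans]: "x \<approx> y \<Longrightarrow> y \<approx> z \<Longrightarrow> x \<approx> z"
  using triangle_sub[of x y z] nonneg[of "x - z"] by (simp add: null_eq_def free_carrier_diff)

lemma null_eq_add: "x \<approx> x' \<Longrightarrow> y \<approx> y' \<Longrightarrow> x + y \<approx> x' + y'"
  using triangle[of "x - x'" "y - y'"] nonneg[of "x + y - (x' + y')"]
  by (simp add: null_eq_def free_carrier_intros add_diff_add)

lemma null_eq_uminus: "x \<approx> x' \<Longrightarrow> - x \<approx> - x'"
  using uminus[of "x - x'"] minus_commute[of x' x]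
  by (simp add: null_eq_def free_carrier_intros)

lemma null_eq_diff: "x \<approx> x' \<Longrightarrow> y \<approx> y' \<Longrightarrow> x - y \<approx> x' - y'"
  using null_eq_add[OF _ null_eq_uminus, of x x' y y'] by simp

lemma null_eq_mult: "x \<approx> x' \<Longrightarrow> y \<approx> y' \<Longrightarrow> x * y \<approx> x' * y'"
  using mult_diff_le[of x y x' y'] nonneg[of "x * y - x' * y'"]
  by (simp add: null_eq_def free_carrier_intros)

lemma null_eq_sum: "(\<And>i. i \<in> A \<Longrightarrow> h i \<approx> k i) \<Longrightarrow> sum h A \<approx> sum k A"
  by (induction A rule: infinite_finite_induct) (simp_all add: null_eq_refl null_eq_add)

text \<open>A letter and its adjoint have equal seminorm, and submultiplicativity carries the bound
  from letters to words.\<close>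

lemma single_le_one:
  assumes gen: "\<And>g. g \<in> G \<Longrightarrow> p (free_gen g) \<le> 1"
    and "letters u \<noteq> []" "fst ` set (letters u) \<subseteq> G"
  shows "p (Poly_Mapping.single u 1) \<le> 1"
proof -
  have letter: "p (Poly_Mapping.single (Star_Word [l]) 1) \<le> 1 \<and>
      Poly_Mapping.single (Star_Word [l]) 1 \<in> free_carrier G" if "fst l \<in> G" for l
  proof (cases "snd l")
    case True
    then have "Poly_Mapping.single (Star_Word [l]) 1 = free_adj (free_gen (fst l))"
      by (cases l) (simp add: free_gen_def free_adj_single word_adj_def)
    then show ?thesis
      using that gen by (simp add: adj free_carrier_intros)
  next
    case False
    then have "Poly_Mapping.single (Star_Word [l]) 1 = free_gen (fst l)"
      by (cases l) (simp add: free_gen_def)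
    then show ?thesis
      using that gen by (simp add: free_carrier_intros)
  qed
  have "p (Poly_Mapping.single (Star_Word ls) 1) \<le> 1 \<and>
      Poly_Mapping.single (Star_Word ls) 1 \<in> free_carrier G"
    if "ls \<noteq> []" "fst ` set ls \<subseteq> G" for ls
    using that
  proof (induction ls rule: list_nonempty_induct)
    case (cons l ls)
    let ?x = "Poly_Mapping.single (Star_Word [l]) (1 :: complex)"
    let ?y = "Poly_Mapping.single (Star_Word ls) (1 :: complex)"
    have "Poly_Mapping.single (Star_Word (l # ls)) 1 = ?x * ?y"
      by (simp add: mult_single plus_star_word_def)
    moreover have "p (?x * ?y) \<le> p ?x * p ?y"
      using cons letter[of l] by (auto intro!: submult)
    moreover have "p ?x * p ?y \<le> 1"
      using cons letter[of l] by (auto intro!: mult_le_one nonneg)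
    ultimately show ?case
      using cons letter[of l] by (simp add: free_carrier_intros)
  qed (use letter in simp)
  from this[OF assms(2,3)] show ?thesis by simp
qed

text \<open>The bound depends on \<open>x\<close> alone and not on \<open>p\<close>, so it holds for
  all admissible seminorms at once and makes their supremum finite.\<close>

lemma le_sum_coefficients:
  assumes "\<And>g. g \<in> G \<Longrightarrow> p (free_gen g) \<le> 1" and x: "x \<in> free_carrier G"
  shows "p x \<le> (\<Sum>u\<in>Poly_Mapping.keys x. cmod (Poly_Mapping.lookup x u))"
proof -
  have single: "Poly_Mapping.single u 1 \<in> free_carrier G" "p (Poly_Mapping.single u 1) \<le> 1"
    if "u \<in> Poly_Mapping.keys x" for u
    using that x single_le_one[OF assms(1)] by (auto simp: free_carrier_def)
  have "p x = p (\<Sum>u\<in>Poly_Mapping.keys x.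
      free_scale (Poly_Mapping.lookup x u) (Poly_Mapping.single u 1))"
    by (simp add: free_scale_single flip: poly_mapping_sum_singles)
  also have "\<dots> \<le> (\<Sum>u\<in>Poly_Mapping.keys x.
      p (free_scale (Poly_Mapping.lookup x u) (Poly_Mapping.single u 1)))"
    by (intro sum_le free_carrier_scale single)
  also have "\<dots> \<le> (\<Sum>u\<in>Poly_Mapping.keys x. cmod (Poly_Mapping.lookup x u))"
    by (intro sum_mono) (simp add: scale single mult_left_le)
  finally show ?thesis .
qed

end

section \<open>The supremum of the admissible seminorms\<close>

locale bounded_presentation =
  fixes G :: "'g set" and Rel :: "'g free_alg set"
  assumes bounded: "x \<in> free_carrier G \<Longrightarrow>
    \<exists>B. \<forall>p. cstar_seminorm G p \<and> (\<forall>r\<in>Rel. p r = 0) \<longrightarrow> p x \<le> B"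
begin

text \<open>A real \<open>Sup\<close> is an upper bound only of a set bounded above;
  \<open>bounded\<close> is assumed for this purpose.\<close>

lemma universal_norm_upper:
  assumes "x \<in> free_carrier G" "cstar_seminorm G p" "\<And>r. r \<in> Rel \<Longrightarrow> p r = 0"
  shows "p x \<le> universal_norm G Rel x"
  unfolding universal_norm_def
  by (rule cSup_upper) (use assms bounded[OF assms(1)] in \<open>auto simp: bdd_above_def\<close>)

lemma cstar_seminorm_zero: "cstar_seminorm G (\<lambda>_. 0)"
  by (simp add: cstar_seminorm_def)

lemma universal_norm_least:
  assumes "\<And>p. cstar_seminorm G p \<Longrightarrow> (\<And>r. r \<in> Rel \<Longrightarrow> p r = 0) \<Longrightarrow> p x \<le> B"
  shows "universal_norm G Rel x \<le> B"
  unfolding universal_norm_def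
  by (rule cSup_least) (use assms cstar_seminorm_zero in auto)

lemma universal_norm_rel [simp]:
  assumes "r \<in> Rel" shows "universal_norm G Rel r = 0"
proof -
  have "{p r | p. cstar_seminorm G p \<and> (\<forall>r\<in>Rel. p r = 0)} = {0}"
    using assms cstar_seminorm_zero by auto
  then show ?thesis by (simp add: universal_norm_def)
qed

text \<open>
  Since the supremum is itself a C*-seminorm killing the relators, computations modulo the relations
  need only this one seminorm.
\<close>

lemma cstar_seminorm_universal_norm: "cstar_seminorm G (universal_norm G Rel)"
proof -
  let ?U = "universal_norm G Rel"
  have U_nonneg: "0 \<le> ?U x" if "x \<in> free_carrier G" for x
    using universal_norm_upper[OF that cstar_seminorm_zero] by simp
  have scale_le: "?U (free_scale c x) \<le> cmod c * ?U x" if x: "x \<in> free_carrier G" for c x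
  proof (rule universal_norm_least)
    fix p assume p: "cstar_seminorm G p" "\<And>r. r \<in> Rel \<Longrightarrow> p r = 0"
    interpret free_cstar_seminorm G p by standard (fact p)
    show "p (free_scale c x) \<le> cmod c * ?U x"
      using universal_norm_upper[OF x p] by (simp add: scale x mult_left_mono)
  qed
  have scale: "?U (free_scale c x) = cmod c * ?U x" if x: "x \<in> free_carrier G" for c x
  proof (cases "c = 0")
    case True
    then show ?thesis using scale_le[OF x, of 0] U_nonneg[of 0] by simp
  next
    case False
    \<comment> \<open>The opposite inequality is the first one applied to
      \<open>free_scale c x\<close> and the factor \<open>inverse c\<close>, hence the separate case
      \<open>c = 0\<close>.\<close>
    have "?U x \<le> cmod (inverse c) * ?U (free_scale c x)"
      using scale_le[of "free_scale c x" "inverse c"] x False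
      by (simp add: free_scale_scale free_carrier_scale)
    then have "cmod c * ?U x \<le> ?U (free_scale c x)"
      using False by (simp add: norm_divide field_simps)
    then show ?thesis using scale_le[OF x, of c] by simp
  qed
  have add: "?U (x + y) \<le> ?U x + ?U y" if "x \<in> free_carrier G" "y \<in> free_carrier G" for x y
  proof (rule universal_norm_least)
    fix p assume p: "cstar_seminorm G p" "\<And>r. r \<in> Rel \<Longrightarrow> p r = 0"
    interpret free_cstar_seminorm G p by standard (fact p)
    show "p (x + y) \<le> ?U x + ?U y"
      using triangle[OF that] universal_norm_upper[OF that(1) p] universal_norm_upper[OF that(2) p]
      by simp
  qed
  have mult: "?U (x * y) \<le> ?U x * ?U y" if "x \<in> free_carrier G" "y \<in> free_carrier G" for x y
  proof (rule universal_norm_least)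
    fix p assume p: "cstar_seminorm G p" "\<And>r. r \<in> Rel \<Longrightarrow> p r = 0"
    interpret free_cstar_seminorm G p by standard (fact p)
    have "p x * p y \<le> ?U x * ?U y"
      using that by (intro mult_mono universal_norm_upper p U_nonneg nonneg)
    then show "p (x * y) \<le> ?U x * ?U y"
      using submult[OF that] by simp
  qed
  have adj_le: "?U (free_adj x) \<le> ?U x" if "x \<in> free_carrier G" for x
  proof (rule universal_norm_least)
    fix p assume p: "cstar_seminorm G p" "\<And>r. r \<in> Rel \<Longrightarrow> p r = 0"
    interpret free_cstar_seminorm G p by standard (fact p)
    show "p (free_adj x) \<le> ?U x"
      using adj[OF that] universal_norm_upper[OF that p] by simp
  qed
  have adj: "?U (free_adj x) = ?U x" if "x \<in> free_carrier G" for x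
    using adj_le[of x] adj_le[of "free_adj x"] that by (simp add: free_carrier_adj)
  have "(?U x)\<^sup>2 \<le> ?U (free_adj x * x)" if x: "x \<in> free_carrier G" for x
  proof -
    have xx: "free_adj x * x \<in> free_carrier G"
      by (simp add: x free_carrier_intros)
    \<comment> \<open>The least-upper-bound property compares values of \<open>p\<close>, not their
      squares, so the C*-identity is used in square-root form.\<close>
    have "?U x \<le> sqrt (?U (free_adj x * x))"
    proof (rule universal_norm_least)
      fix p assume p: "cstar_seminorm G p" "\<And>r. r \<in> Rel \<Longrightarrow> p r = 0"
      interpret free_cstar_seminorm G p by standard (fact p)
      have "(p x)\<^sup>2 \<le> ?U (free_adj x * x)"
        using universal_norm_upper[OF xx p] by (simp add: cstar x)
      then show "p x \<le> sqrt (?U (free_adj x * x))"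
        by (rule real_le_rsqrt)
    qed
    then have "(?U x)\<^sup>2 \<le> (sqrt (?U (free_adj x * x)))\<^sup>2"
      using U_nonneg[OF x] by (intro power_mono)
    then show ?thesis using U_nonneg[OF xx] by simp
  qed
  moreover have "?U (free_adj x * x) \<le> (?U x)\<^sup>2" if "x \<in> free_carrier G" for x
    using mult[of "free_adj x" x] adj[OF that] that by (simp add: free_carrier_adj power2_eq_square)
  ultimately show ?thesis
    unfolding cstar_seminorm_def using U_nonneg scale add mult adj by (simp add: antisym)
qed

sublocale free_cstar_seminorm G "universal_norm G Rel"
  by standard (rule cstar_seminorm_universal_norm)

end

lemma bounded_presentationI:
  assumes "\<And>p g. cstar_seminorm G p \<Longrightarrow> (\<And>r. r \<in> Rel \<Longrightarrow> p r = 0) \<Longrightarrow> g \<in> G \<Longrightarrow> p (free_gen g) \<le> 1"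
  shows "bounded_presentation G Rel"
proof
  fix x assume x: "x \<in> free_carrier G"
  have "p x \<le> (\<Sum>u\<in>Poly_Mapping.keys x. cmod (Poly_Mapping.lookup x u))"
    if "cstar_seminorm G p \<and> (\<forall>r\<in>Rel. p r = 0)" for p
    by (rule free_cstar_seminorm.le_sum_coefficients) (use that assms x in \<open>auto simp: free_cstar_seminorm_def\<close>)
  then show "\<exists>B. \<forall>p. cstar_seminorm G p \<and> (\<forall>r\<in>Rel. p r = 0) \<longrightarrow> p x \<le> B"
    by blast
qed

section \<open>The universal C*-algebra and its functoriality\<close>

context bounded_presentation
begin

notation null_eq (infix "\<approx>" 50)

abbreviation U :: "'g free_alg \<Rightarrow> real" where "U \<equiv> universal_norm G Rel"

abbreviation cls :: "(nat \<Rightarrow> 'g free_alg) \<Rightarrow> (nat \<Rightarrow> 'g free_alg) set" where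
  "cls x \<equiv> null_rel G Rel `` {x}"

section \<open>Cauchy sequences and null sequences\<close>

lemma cauchy_seqs_carrier: "x \<in> cauchy_seqs G Rel \<Longrightarrow> x n \<in> free_carrier G"
  by (simp add: cauchy_seqs_def)

lemma cauchy_seqsD:
  "x \<in> cauchy_seqs G Rel \<Longrightarrow> 0 < \<epsilon> \<Longrightarrow> \<exists>M. \<forall>m\<ge>M. \<forall>n\<ge>M. U (x m - x n) < \<epsilon>"
  by (simp add: cauchy_seqs_def)

lemma cauchy_seqs_const: "x \<in> free_carrier G \<Longrightarrow> (\<lambda>_. x) \<in> cauchy_seqs G Rel"
  by (simp add: cauchy_seqs_def)

text \<open>By the reverse triangle inequality the norms form a real Cauchy sequence. The bound
  serves as the Lipschitz factor for products.\<close>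

lemma cauchy_seqs_bound:
  assumes x: "x \<in> cauchy_seqs G Rel"
  obtains K where "0 < K" "\<And>n. U (x n) \<le> K"
proof -
  have "Cauchy (\<lambda>n. U (x n))"
    unfolding Cauchy_def dist_real_def
  proof (intro allI impI)
    fix \<epsilon> :: real assume "0 < \<epsilon>"
    then obtain M where "\<forall>m\<ge>M. \<forall>n\<ge>M. U (x m - x n) < \<epsilon>"
      using cauchy_seqsD[OF x] by blast
    then show "\<exists>M. \<forall>m\<ge>M. \<forall>n\<ge>M. \<bar>U (x m) - U (x n)\<bar> < \<epsilon>"
      using abs_diff_le[OF cauchy_seqs_carrier[OF x] cauchy_seqs_carrier[OF x]]
      by (meson order_le_less_trans)
  qed
  then obtain K where "0 < K" "\<And>n. norm (U (x n)) \<le> K"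
    using BseqE[OF Cauchy_Bseq] by metis
  then show thesis
    using that[of K] by (simp add: abs_le_iff)
qed

text \<open>One criterion for all four operations: a Lipschitz estimate in two arguments. For a
  unary operation the same sequence fills both slots.\<close>

lemma cauchy_seqs_dominated:
  assumes x: "x \<in> cauchy_seqs G Rel" and y: "y \<in> cauchy_seqs G Rel" and K: "0 < K"
    and z: "\<And>n. z n \<in> free_carrier G"
    and le: "\<And>m n. U (z m - z n) \<le> K * (U (x m - x n) + U (y m - y n))"
  shows "z \<in> cauchy_seqs G Rel"
  unfolding cauchy_seqs_def
proof (intro CollectI conjI allI impI)
  fix \<epsilon> :: real assume "0 < \<epsilon>"
  then have pos: "0 < \<epsilon> / (2 * K)" using K by simp
  obtain M M' where M: "\<And>m n. m \<ge> M \<Longrightarrow> n \<ge> M \<Longrightarrow> U (x m - x n) < \<epsilon> / (2 * K)"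
    and M': "\<And>m n. m \<ge> M' \<Longrightarrow> n \<ge> M' \<Longrightarrow> U (y m - y n) < \<epsilon> / (2 * K)"
    using cauchy_seqsD[OF x pos] cauchy_seqsD[OF y pos] by blast
  have "U (z m - z n) < \<epsilon>" if "m \<ge> max M M'" "n \<ge> max M M'" for m n
  proof -
    have "U (x m - x n) + U (y m - y n) < \<epsilon> / (2 * K) + \<epsilon> / (2 * K)"
      using M[of m n] M'[of m n] that by linarith
    then have "K * (U (x m - x n) + U (y m - y n)) < K * (\<epsilon> / (2 * K) + \<epsilon> / (2 * K))"
      using K by (intro mult_strict_left_mono)
    also have "\<dots> = \<epsilon>" using K by simp
    finally show ?thesis using le[of m n] by linarith
  qed
  then show "\<exists>M. \<forall>m\<ge>M. \<forall>n\<ge>M. U (z m - z n) < \<epsilon>" by blast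
qed (rule z)

text \<open>Counterpart of \<open>cauchy_seqs_dominated\<close> for well-definedness on classes;
  unary operations fill the second slot with a pair \<open>(x, x)\<close>, whose distance is 0.
  Transitivity is the case \<open>K = 1\<close>.\<close>

lemma null_rel_dominated:
  assumes x: "(x, x') \<in> null_rel G Rel" and y: "(y, y') \<in> null_rel G Rel"
    and z: "z \<in> cauchy_seqs G Rel" "z' \<in> cauchy_seqs G Rel"
    and le: "\<And>n. U (z n - z' n) \<le> K * (U (x n - x' n) + U (y n - y' n))"
  shows "(z, z') \<in> null_rel G Rel"
proof -
  have "(\<lambda>n. U (x n - x' n)) \<longlonglongrightarrow> 0" "(\<lambda>n. U (y n - y' n)) \<longlonglongrightarrow> 0"
    using x y by (auto simp: null_rel_def)
  then have lim: "(\<lambda>n. K * (U (x n - x' n) + U (y n - y' n))) \<longlonglongrightarrow> 0"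
    by (auto intro!: tendsto_eq_intros)
  have "(\<lambda>n. U (z n - z' n)) \<longlonglongrightarrow> 0"
  proof (rule tendsto_sandwich[OF _ _ tendsto_const lim])
    show "\<forall>\<^sub>F n in sequentially. 0 \<le> U (z n - z' n)"
      using z by (simp add: nonneg free_carrier_diff cauchy_seqs_carrier)
    show "\<forall>\<^sub>F n in sequentially. U (z n - z' n) \<le> K * (U (x n - x' n) + U (y n - y' n))"
      using le by simp
  qed
  then show ?thesis using z by (simp add: null_rel_def)
qed

lemma null_rel_refl: "x \<in> cauchy_seqs G Rel \<Longrightarrow> (x, x) \<in> null_rel G Rel"
  by (simp add: null_rel_def)

lemma null_relD: "(x, y) \<in> null_rel G Rel \<Longrightarrow> x \<in> cauchy_seqs G Rel"
  "(x, y) \<in> null_rel G Rel \<Longrightarrow> y \<in> cauchy_seqs G Rel"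
  by (simp_all add: null_rel_def)

lemma null_rel_sym: "(x, y) \<in> null_rel G Rel \<Longrightarrow> (y, x) \<in> null_rel G Rel"
  by (auto simp: null_rel_def minus_commute[OF cauchy_seqs_carrier cauchy_seqs_carrier, of x y])

lemma null_rel_trans:
  assumes "(x, y) \<in> null_rel G Rel" "(y, z) \<in> null_rel G Rel"
  shows "(x, z) \<in> null_rel G Rel"
  using assms
  by (rule null_rel_dominated[where K = 1])
     (use assms in \<open>auto simp: null_relD intro!: triangle_sub cauchy_seqs_carrier\<close>)

lemma equiv_null_rel: "equiv (cauchy_seqs G Rel) (null_rel G Rel)"
proof (rule equivI)
  show "null_rel G Rel \<subseteq> cauchy_seqs G Rel \<times> cauchy_seqs G Rel"
    by (auto simp: null_rel_def)
  show "refl_on (cauchy_seqs G Rel) (null_rel G Rel)"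
    by (auto simp: refl_on_def null_rel_refl)
  show "sym (null_rel G Rel)" by (auto intro: symI null_rel_sym)
  show "trans (null_rel G Rel)" by (auto intro: transI null_rel_trans)
qed

lemma cauchy_seqs_add:
  assumes "x \<in> cauchy_seqs G Rel" "y \<in> cauchy_seqs G Rel"
  shows "(\<lambda>n. x n + y n) \<in> cauchy_seqs G Rel"
proof (rule cauchy_seqs_dominated[OF assms, of 1])
  fix m n
  show "U (x m + y m - (x n + y n)) \<le> 1 * (U (x m - x n) + U (y m - y n))"
    using triangle[of "x m - x n" "y m - y n"] assms
    by (simp add: add_diff_add free_carrier_diff cauchy_seqs_carrier)
qed (use assms in \<open>simp_all add: cauchy_seqs_carrier free_carrier_add\<close>)

lemma cauchy_seqs_scale:
  assumes "x \<in> cauchy_seqs G Rel"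
  shows "(\<lambda>n. free_scale c (x n)) \<in> cauchy_seqs G Rel"
\<comment> \<open>The summand 1 keeps the factor positive when \<open>c = 0\<close>.\<close>
proof (rule cauchy_seqs_dominated[OF assms assms, of "cmod c + 1"])
  fix m n
  have "0 \<le> U (x m - x n)"
    using assms by (simp add: nonneg free_carrier_diff cauchy_seqs_carrier)
  then show "U (free_scale c (x m) - free_scale c (x n))
      \<le> (cmod c + 1) * (U (x m - x n) + U (x m - x n))"
    using scale[of "x m - x n" c] assms
    by (simp add: free_scale_diff free_carrier_diff cauchy_seqs_carrier algebra_simps)
qed (use assms in \<open>simp_all add: cauchy_seqs_carrier free_carrier_scale add_nonneg_pos\<close>)

lemma cauchy_seqs_adj:
  assumes "x \<in> cauchy_seqs G Rel"
  shows "(\<lambda>n. free_adj (x n)) \<in> cauchy_seqs G Rel"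
proof (rule cauchy_seqs_dominated[OF assms assms, of 1])
  fix m n
  show "U (free_adj (x m) - free_adj (x n)) \<le> 1 * (U (x m - x n) + U (x m - x n))"
    using adj[of "x m - x n"] nonneg[of "x m - x n"] assms
    by (simp add: free_carrier_diff cauchy_seqs_carrier free_adj_diff)
qed (use assms in \<open>simp_all add: cauchy_seqs_carrier free_carrier_adj\<close>)

text \<open>Splitting the difference leaves the first factor of one product and the second factor of
  the other, so one bound for each sequence suffices.\<close>

lemma mult_diff_le_bound:
  assumes "x \<in> free_carrier G" "y \<in> free_carrier G" "x' \<in> free_carrier G" "y' \<in> free_carrier G"
    and "U x \<le> K" "U y' \<le> K'"
  shows "U (x * y - x' * y') \<le> (max K K') * (U (x - x') + U (y - y'))"
proof -
  have "U x * U (y - y') + U (x - x') * U y'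
      \<le> max K K' * U (y - y') + U (x - x') * max K K'"
    using assms by (intro add_mono mult_right_mono mult_left_mono)
      (auto simp: nonneg free_carrier_diff)
  then show ?thesis
    using mult_diff_le[OF assms(1-4)] by (simp add: algebra_simps)
qed

lemma cauchy_seqs_mult:
  assumes x: "x \<in> cauchy_seqs G Rel" and y: "y \<in> cauchy_seqs G Rel"
  shows "(\<lambda>n. x n * y n) \<in> cauchy_seqs G Rel"
proof -
  obtain K where K: "0 < K" "\<And>n. U (x n) \<le> K" using cauchy_seqs_bound[OF x] by blast
  obtain K' where K': "0 < K'" "\<And>n. U (y n) \<le> K'" using cauchy_seqs_bound[OF y] by blast
  show ?thesis
    by (rule cauchy_seqs_dominated[OF x y, of "max K K'"])
       (use K K' x y in \<open>auto intro!: mult_diff_le_bound simp: cauchy_seqs_carrier free_carrier_mult\<close>)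
qed

lemma null_rel_add:
  assumes x: "(x, x') \<in> null_rel G Rel" and y: "(y, y') \<in> null_rel G Rel"
  shows "((\<lambda>n. x n + y n), (\<lambda>n. x' n + y' n)) \<in> null_rel G Rel"
proof (rule null_rel_dominated[OF x y, where K = 1])
  fix n
  show "U (x n + y n - (x' n + y' n)) \<le> 1 * (U (x n - x' n) + U (y n - y' n))"
    using triangle[of "x n - x' n" "y n - y' n"] x y
    by (simp add: add_diff_add free_carrier_diff cauchy_seqs_carrier null_relD)
qed (use x y in \<open>auto intro!: cauchy_seqs_add simp: null_relD\<close>)

lemma null_rel_scale:
  assumes x: "(x, x') \<in> null_rel G Rel"
  shows "((\<lambda>n. free_scale c (x n)), (\<lambda>n. free_scale c (x' n))) \<in> null_rel G Rel"
proof (rule null_rel_dominated[OF x null_rel_refl[OF null_relD(1)[OF x]], where K = "cmod c"])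
  fix n
  show "U (free_scale c (x n) - free_scale c (x' n)) \<le> cmod c * (U (x n - x' n) + U (x n - x n))"
    using scale[of "x n - x' n" c] x
    by (simp add: free_scale_diff free_carrier_diff cauchy_seqs_carrier null_relD)
qed (use x in \<open>auto intro!: cauchy_seqs_scale simp: null_relD\<close>)

lemma null_rel_adj:
  assumes x: "(x, x') \<in> null_rel G Rel"
  shows "((\<lambda>n. free_adj (x n)), (\<lambda>n. free_adj (x' n))) \<in> null_rel G Rel"
proof (rule null_rel_dominated[OF x null_rel_refl[OF null_relD(1)[OF x]], where K = 1])
  fix n
  show "U (free_adj (x n) - free_adj (x' n)) \<le> 1 * (U (x n - x' n) + U (x n - x n))"
    using adj[of "x n - x' n"] x
    by (simp add: free_carrier_diff cauchy_seqs_carrier null_relD free_adj_diff)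
qed (use x in \<open>auto intro!: cauchy_seqs_adj simp: null_relD\<close>)

lemma null_rel_mult:
  assumes x: "(x, x') \<in> null_rel G Rel" and y: "(y, y') \<in> null_rel G Rel"
  shows "((\<lambda>n. x n * y n), (\<lambda>n. x' n * y' n)) \<in> null_rel G Rel"
proof -
  obtain K where K: "\<And>n. U (x n) \<le> K" using cauchy_seqs_bound[OF null_relD(1)[OF x]] by blast
  obtain K' where K': "\<And>n. U (y' n) \<le> K'" using cauchy_seqs_bound[OF null_relD(2)[OF y]] by blast
  show ?thesis
    by (rule null_rel_dominated[OF x y, where K = "max K K'"])
       (use K K' x y in \<open>auto intro!: mult_diff_le_bound cauchy_seqs_mult
          simp: cauchy_seqs_carrier null_relD\<close>)
qed

lemma cls_eqI: "(x, y) \<in> null_rel G Rel \<Longrightarrow> cls x = cls y"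
  by (rule equiv_class_eq[OF equiv_null_rel])

lemma cls_const_eqI: "x \<approx> y \<Longrightarrow> cls (\<lambda>_. x) = cls (\<lambda>_. y)"
  by (rule cls_eqI) (simp add: null_rel_def null_eq_def cauchy_seqs_const)

section \<open>Operations of the universal C*-algebra on representatives\<close>

lemma ccarrier_universal_cstar: "ccarrier (universal_cstar G Rel) = cauchy_seqs G Rel // null_rel G Rel"
  by (simp add: universal_cstar_def Let_def)

lemma cls_in_ccarrier: "x \<in> cauchy_seqs G Rel \<Longrightarrow> cls x \<in> ccarrier (universal_cstar G Rel)"
  by (simp add: ccarrier_universal_cstar quotientI)

lemma ccarrierE:
  assumes "X \<in> ccarrier (universal_cstar G Rel)"
  obtains x where "x \<in> cauchy_seqs G Rel" "X = cls x"
  using assms unfolding ccarrier_universal_cstar by (rule quotientE)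

lemma cadd_cls:
  assumes "x \<in> cauchy_seqs G Rel" "y \<in> cauchy_seqs G Rel"
  shows "cadd (universal_cstar G Rel) (cls x) (cls y) = cls (\<lambda>n. x n + y n)"
proof -
  have "congruent2 (null_rel G Rel) (null_rel G Rel) (\<lambda>x y. cls (\<lambda>n. x n + y n))"
    by (auto simp: congruent2_def intro!: cls_eqI null_rel_add)
  from UN_equiv_class2[OF equiv_null_rel equiv_null_rel this assms] show ?thesis
    by (simp add: universal_cstar_def Let_def)
qed

lemma cmult_cls:
  assumes "x \<in> cauchy_seqs G Rel" "y \<in> cauchy_seqs G Rel"
  shows "cmult (universal_cstar G Rel) (cls x) (cls y) = cls (\<lambda>n. x n * y n)"
proof -
  have "congruent2 (null_rel G Rel) (null_rel G Rel) (\<lambda>x y. cls (\<lambda>n. x n * y n))"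
    by (auto simp: congruent2_def intro!: cls_eqI null_rel_mult)
  from UN_equiv_class2[OF equiv_null_rel equiv_null_rel this assms] show ?thesis
    by (simp add: universal_cstar_def Let_def)
qed

lemma cscale_cls:
  assumes "x \<in> cauchy_seqs G Rel"
  shows "cscale (universal_cstar G Rel) c (cls x) = cls (\<lambda>n. free_scale c (x n))"
proof -
  have "congruent (null_rel G Rel) (\<lambda>x. cls (\<lambda>n. free_scale c (x n)))"
    by (auto simp: congruent_def intro!: cls_eqI null_rel_scale)
  from UN_equiv_class[OF equiv_null_rel this assms] show ?thesis
    by (simp add: universal_cstar_def Let_def)
qed

lemma cadj_cls:
  assumes "x \<in> cauchy_seqs G Rel"
  shows "cadj (universal_cstar G Rel) (cls x) = cls (\<lambda>n. free_adj (x n))"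
proof -
  have "congruent (null_rel G Rel) (\<lambda>x. cls (\<lambda>n. free_adj (x n)))"
    by (auto simp: congruent_def intro!: cls_eqI null_rel_adj)
  from UN_equiv_class[OF equiv_null_rel this assms] show ?thesis
    by (simp add: universal_cstar_def Let_def)
qed

end

section \<open>Functoriality in the presentation\<close>

locale presentation_map = dom: bounded_presentation G Rel + cod: bounded_presentation H Rel'
  for G :: "'g set" and Rel and H :: "'h set" and Rel' +
  fixes a :: "'g \<Rightarrow> 'h free_alg"
  assumes gen_in: "g \<in> G \<Longrightarrow> a g \<in> free_carrier H"
    and relator_null: "r \<in> Rel \<Longrightarrow> universal_norm H Rel' (free_extend a r) = 0"
begin

lemma free_extend_in [simp]: "x \<in> free_carrier G \<Longrightarrow> free_extend a x \<in> free_carrier H"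
  using free_extend_carrier gen_in by blast

text \<open>
  Pulling back the universal norm gives a C*-seminorm that kills the relators of the domain, hence
  one that is dominated by the universal norm there.
\<close>

lemma universal_norm_free_extend_le:
  assumes "x \<in> free_carrier G"
  shows "universal_norm H Rel' (free_extend a x) \<le> universal_norm G Rel x"
proof (rule dom.universal_norm_upper[OF assms])
  show "cstar_seminorm G (\<lambda>x. universal_norm H Rel' (free_extend a x))"
    unfolding cstar_seminorm_def
    by (auto simp: cod.nonneg cod.scale cod.triangle cod.submult cod.adj cod.cstar
        free_extend_scale free_extend_add free_extend_mult free_extend_adj)
qed (rule relator_null)

text \<open>Generators are sent into the free algebra of the codomain, before completion, so the map
  can be applied to Cauchy sequences term by term. The union runs over representatives whose image
  classes coincide.\<close>

definition induced :: "(nat \<Rightarrow> 'g free_alg) set \<Rightarrow> (nat \<Rightarrow> 'h free_alg) set" where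
  "induced X = (\<Union>x\<in>X. cod.cls (\<lambda>n. free_extend a (x n)))"

lemma cauchy_seqs_free_extend:
  assumes x: "x \<in> cauchy_seqs G Rel"
  shows "(\<lambda>n. free_extend a (x n)) \<in> cauchy_seqs H Rel'"
proof -
  have "cod.U (free_extend a (x m) - free_extend a (x n)) \<le> dom.U (x m - x n)" for m n
    using universal_norm_free_extend_le[of "x m - x n"] x
    by (simp add: dom.cauchy_seqs_carrier free_extend_diff free_carrier_diff)
  then show ?thesis
    using x unfolding cauchy_seqs_def by (auto intro: le_less_trans) (meson le_less_trans)
qed

lemma null_rel_free_extend:
  assumes x: "(x, y) \<in> null_rel G Rel"
  shows "((\<lambda>n. free_extend a (x n)), (\<lambda>n. free_extend a (y n))) \<in> null_rel H Rel'"
proof -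
  have in_carrier: "x n \<in> free_carrier G" "y n \<in> free_carrier G" for n
    using x by (auto simp: dom.null_relD dom.cauchy_seqs_carrier)
  have "(\<lambda>n. cod.U (free_extend a (x n) - free_extend a (y n))) \<longlonglongrightarrow> 0"
  proof (rule tendsto_sandwich[OF _ _ tendsto_const])
    show "(\<lambda>n. dom.U (x n - y n)) \<longlonglongrightarrow> 0" using x by (simp add: null_rel_def)
    show "\<forall>\<^sub>F n in sequentially. cod.U (free_extend a (x n) - free_extend a (y n)) \<le> dom.U (x n - y n)"
      using universal_norm_free_extend_le[of "x _ - y _"] in_carrier
      by (simp add: free_extend_diff free_carrier_diff)
    show "\<forall>\<^sub>F n in sequentially. 0 \<le> cod.U (free_extend a (x n) - free_extend a (y n))"
      using in_carrier by (simp add: free_carrier_diff cod.nonneg)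
  qed
  then show ?thesis
    using dom.null_relD[OF x] by (simp add: null_rel_def cauchy_seqs_free_extend)
qed

lemma induced_cls:
  assumes "x \<in> cauchy_seqs G Rel"
  shows "induced (dom.cls x) = cod.cls (\<lambda>n. free_extend a (x n))"
proof -
  have "congruent (null_rel G Rel) (\<lambda>x. cod.cls (\<lambda>n. free_extend a (x n)))"
    by (auto simp: congruent_def intro!: cod.cls_eqI null_rel_free_extend)
  from UN_equiv_class[OF dom.equiv_null_rel this assms] show ?thesis
    by (simp add: induced_def)
qed

lemma induced_universal_gen: "g \<in> G \<Longrightarrow> induced (universal_gen G Rel g) = cod.cls (\<lambda>_. a g)"
  by (simp add: universal_gen_def induced_cls dom.cauchy_seqs_const free_carrier_gen)

theorem star_hom_induced: "star_hom (universal_cstar G Rel) (universal_cstar H Rel') induced"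
  unfolding star_hom_def
proof (intro conjI ballI allI)
  fix X assume "X \<in> ccarrier (universal_cstar G Rel)"
  then obtain x where x: "x \<in> cauchy_seqs G Rel" "X = dom.cls x" by (rule dom.ccarrierE)
  note simps = x induced_cls cauchy_seqs_free_extend
  show "induced X \<in> ccarrier (universal_cstar H Rel')"
    by (simp add: simps cod.cls_in_ccarrier)
  show "induced (cadj (universal_cstar G Rel) X) = cadj (universal_cstar H Rel') (induced X)"
    by (simp add: simps dom.cadj_cls cod.cadj_cls dom.cauchy_seqs_adj free_extend_adj)
  show "induced (cscale (universal_cstar G Rel) c X) = cscale (universal_cstar H Rel') c (induced X)" for c
    by (simp add: simps dom.cscale_cls cod.cscale_cls dom.cauchy_seqs_scale free_extend_scale)
  fix Y assume "Y \<in> ccarrier (universal_cstar G Rel)"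
  then obtain y where y: "y \<in> cauchy_seqs G Rel" "Y = dom.cls y" by (rule dom.ccarrierE)
  show "induced (cadd (universal_cstar G Rel) X Y) = cadd (universal_cstar H Rel') (induced X) (induced Y)"
    by (simp add: simps y dom.cadd_cls cod.cadd_cls dom.cauchy_seqs_add free_extend_add)
  show "induced (cmult (universal_cstar G Rel) X Y) = cmult (universal_cstar H Rel') (induced X) (induced Y)"
    by (simp add: simps y dom.cmult_cls cod.cmult_cls dom.cauchy_seqs_mult free_extend_mult)
qed

end

section \<open>The graph inverse semigroup\<close>

notation gis_mult (infixl "\<cdot>" 70)

text \<open>
  The pair \<open>(\<alpha>, \<beta>)\<close> acts as the partial injection \<open>\<beta>\<gamma> \<mapsto> \<alpha>\<gamma>\<close>. The action is faithful even without
  requiring that edge lists are paths, so associativity holds for all terms of the type.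
\<close>

definition gis_rep :: "('v, 'e) gis \<Rightarrow> ('v, 'e) path \<Rightarrow> ('v, 'e) path option" where
  "gis_rep s x = (case s of None \<Rightarrow> None | Some ((a, p), (b, q)) \<Rightarrow>
     if fst x = b \<and> prefix q (snd x) then Some (a, p @ drop (length q) (snd x)) else None)"

lemma gis_rep_mult: "gis_rep (s \<cdot> t) x = Option.bind (gis_rep t x) (gis_rep s)"
proof (cases "s = None \<or> t = None")
  case True
  then show ?thesis by (cases s; cases t) (auto simp: gis_rep_def split: Option.bind_split)
next
  case False
  then obtain a p b q c r d u where st: "s = Some ((a, p), (b, q))" "t = Some ((c, r), (d, u))"
    by auto
  show ?thesis
  proof (cases "fst x = d \<and> prefix u (snd x)")
    case False
    then show ?thesis
      by (auto simp: st gis_rep_def dest: append_prefixD)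
  next
    case True
    then obtain z where x: "x = (d, u @ z)" by (cases x) (auto simp: prefix_def)
    \<comment> \<open>Two prefixes of one list are comparable, so lengthening \<open>r\<close>
      cannot bring \<open>q\<close> into the prefix order with it.\<close>
    have "\<not> prefix q (r @ z)" if "\<not> prefix q r" "\<not> prefix r q"
      using that prefix_same_cases[of q "r @ z" r] by auto
    then show ?thesis
      by (auto simp: st x gis_rep_def elim!: prefixE)
  qed
qed

text \<open>Each action is evaluated at the other's base path as well as at its own: definedness
  makes the two base paths prefixes of each other, hence equal, and the values there are the left
  paths.\<close>

lemma gis_rep_inject:
  assumes eq: "gis_rep s = gis_rep t" shows "s = t"
proof -
  have None: "s' = None" if eq': "gis_rep s' = gis_rep None" for s' :: "('a, 'b) gis"
  proof (cases s')
    case (Some y)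
    then obtain a p b q where "s' = Some ((a, p), (b, q))" by (cases y) auto
    then show ?thesis using fun_cong[OF eq', of "(b, q)"] by (simp add: gis_rep_def)
  qed
  show ?thesis
  proof (cases "s = None \<or> t = None")
    case True
    then show ?thesis using None[of s] None[of t] eq by metis
  next
    case False
    then obtain a p b q c r d u where st: "s = Some ((a, p), (b, q))" "t = Some ((c, r), (d, u))"
      by auto
    show ?thesis
      using fun_cong[OF eq, of "(b, q)"] fun_cong[OF eq, of "(d, u)"]
      by (auto simp: st gis_rep_def prefix_def split: if_splits)
  qed
qed

lemma gis_mult_assoc: "(s \<cdot> t) \<cdot> u = s \<cdot> (t \<cdot> u)"
  by (rule gis_rep_inject) (simp add: ext[OF gis_rep_mult])

lemma gis_mult_None [simp]: "None \<cdot> s = None" "s \<cdot> None = None"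
  by (cases s; simp)+

lemma gis_star_simps [simp]: "gis_star None = None" "gis_star (Some (\<alpha>, \<beta>)) = Some (\<beta>, \<alpha>)"
  by (simp_all add: gis_star_def)

lemma gis_star_star [simp]: "gis_star (gis_star s) = s"
  by (cases s) auto

lemma gis_star_mult: "gis_star (s \<cdot> t) = gis_star t \<cdot> gis_star s"
proof (cases "s = None \<or> t = None")
  case False
  then obtain a p b q c r d u where "s = Some ((a, p), (b, q))" "t = Some ((c, r), (d, u))"
    by auto
  then show ?thesis by (auto simp: prefix_def)
qed auto

lemma gis_mult_star_mult: "s \<cdot> gis_star s \<cdot> s = s"
proof (cases s)
  case (Some x)
  then show ?thesis by (cases x) (auto simp: prefix_def)
qed simp

text \<open>A nonzero self-adjoint element has the form \<open>(\<alpha>, \<alpha>)\<close>. This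
  derives idempotence of vertex values from \<open>vertex_star\<close>.\<close>

lemma gis_star_eq_self_mult:
  assumes "gis_star s = s" shows "s \<cdot> s = s"
proof (cases s)
  case (Some x)
  then obtain a p b q where s: "s = Some ((a, p), (b, q))" by (cases x) auto
  with assms have "b = a" "q = p" by (metis gis_star_simps(2) option.inject prod.inject)+
  then show ?thesis by (simp add: s)
qed simp

text \<open>The two equations, read as actions at the base paths of \<open>s\<close> and
  \<open>t\<close>, determine \<open>t\<close>. Consequently a multiplicative map, which preserves
  both equations, also preserves \<open>gis_star\<close>.\<close>

lemma gis_inverse_unique:
  assumes sts: "s \<cdot> t \<cdot> s = s" and tst: "t \<cdot> s \<cdot> t = t"
  shows "t = gis_star s"
proof (cases "s = None \<or> t = None")
  case True
  then show ?thesis using assms by auto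
next
  case False
  then obtain a p b q c r d u where st: "s = Some ((a, p), (b, q))" "t = Some ((c, r), (d, u))"
    by auto
  have "gis_rep (s \<cdot> t \<cdot> s) (b, q) = gis_rep s (b, q)" "gis_rep (t \<cdot> s \<cdot> t) (d, u) = gis_rep t (d, u)"
    by (simp_all add: assms)
  then show ?thesis
    unfolding gis_rep_mult
    by (auto simp: st gis_rep_def prefix_def append_eq_append_conv2 split: if_splits)
qed

context wf_digraph
begin

lemma gis_Some_iff:
  "Some (\<alpha>, \<beta>) \<in> gis G \<longleftrightarrow> (\<exists>v. awalk (fst \<alpha>) (snd \<alpha>) v \<and> awalk (fst \<beta>) (snd \<beta>) v)"
proof -
  have last: "awlast u p = v" if "awalk u p v" for u p v
    using that by (rule awalkE)
  show ?thesis
    by (cases \<alpha>; cases \<beta>) (auto simp: gis_def FP_def path_target_def last)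
qed

lemma gis_None: "None \<in> gis G"
  by (simp add: gis_def)

lemma gis_star_closed: "s \<in> gis G \<Longrightarrow> gis_star s \<in> gis G"
  by (cases s) (auto simp: gis_Some_iff gis_None)

lemma awalk_append_right:
  assumes "awalk u p v" "awalk u (p @ q) w" shows "awalk v q w"
  using assms by (auto simp: awalk_append_iff)

lemma gis_mult_closed:
  assumes "s \<in> gis G" "t \<in> gis G" shows "s \<cdot> t \<in> gis G"
proof (cases "s = None \<or> t = None")
  case True
  then show ?thesis by (auto simp: gis_None)
next
  case False
  then obtain a p b q c r d u where st: "s = Some ((a, p), (b, q))" "t = Some ((c, r), (d, u))"
    by auto
  obtain v w where vw: "awalk a p v" "awalk b q v" "awalk c r w" "awalk d u w"
    using assms by (auto simp: st gis_Some_iff)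
  have "\<exists>x. awalk a (p @ z) x \<and> awalk d u x" if "b = c" "r = q @ z" for z
    using vw that awalk_append_right[of b q v z w] by (blast intro: awalk_appendI)
  moreover have "\<exists>x. awalk a p x \<and> awalk d (u @ z) x" if "b = c" "q = r @ z" for z
    using vw that awalk_append_right[of c r w z v] by (blast intro: awalk_appendI)
  ultimately show ?thesis
    by (auto simp: st gis_Some_iff gis_None prefix_def)
qed

end

section \<open>Extension of generator values to the semigroup\<close>

locale path_hom_generators = dom: wf_digraph E + cod: wf_digraph F
  for E :: "('v, 'e) pre_digraph" and F :: "('x, 'y) pre_digraph" +
  fixes \<phi>0 :: "'v \<Rightarrow> ('x, 'y) gis" and \<phi>1 :: "'e \<Rightarrow> ('x, 'y) gis"
  assumes vertex_in: "v \<in> verts E \<Longrightarrow> \<phi>0 v \<in> gis F"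
    and edge_in: "e \<in> arcs E \<Longrightarrow> \<phi>1 e \<in> gis F"
    and vertex_star: "v \<in> verts E \<Longrightarrow> gis_star (\<phi>0 v) = \<phi>0 v"
    and vertex_orth: "u \<in> verts E \<Longrightarrow> v \<in> verts E \<Longrightarrow> u \<noteq> v \<Longrightarrow> \<phi>0 u \<cdot> \<phi>0 v = None"
    and edge_star_mult: "e \<in> arcs E \<Longrightarrow> gis_star (\<phi>1 e) \<cdot> \<phi>1 e = \<phi>0 (head E e)"
    and edge_orth: "e \<in> arcs E \<Longrightarrow> e' \<in> arcs E \<Longrightarrow> e \<noteq> e' \<Longrightarrow> gis_star (\<phi>1 e) \<cdot> \<phi>1 e' = None"
    and tail_mult: "e \<in> arcs E \<Longrightarrow> \<phi>0 (tail E e) \<cdot> \<phi>1 e = \<phi>1 e"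
begin

text \<open>The product ends with the value of the target vertex, which the last edge absorbs by
  \<open>edge_mult_head\<close>; the path of length 0 is then no exception.\<close>

fun path_value :: "'v \<Rightarrow> 'e list \<Rightarrow> ('x, 'y) gis" where
  "path_value u [] = \<phi>0 u"
| "path_value u (e # es) = \<phi>1 e \<cdot> path_value (head E e) es"

text \<open>The semigroup counterpart of
  \<open>S\<^sub>\<alpha> S\<^sub>\<beta>\<^sup>*\<close>.\<close>

definition hom :: "('v, 'e) gis \<Rightarrow> ('x, 'y) gis" where
  "hom s = (case s of None \<Rightarrow> None
     | Some ((a, p), (b, q)) \<Rightarrow> path_value a p \<cdot> gis_star (path_value b q))"

lemma hom_simps [simp]:
  "hom None = None"
  "hom (Some ((a, p), (b, q))) = path_value a p \<cdot> gis_star (path_value b q)"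
  by (simp_all add: hom_def)

lemma vertex_idem: "v \<in> verts E \<Longrightarrow> \<phi>0 v \<cdot> \<phi>0 v = \<phi>0 v"
  by (rule gis_star_eq_self_mult) (rule vertex_star)

lemma path_value_closed: "dom.awalk u p v \<Longrightarrow> path_value u p \<in> gis F"
  by (induction p arbitrary: u)
     (auto simp: dom.awalk_Nil_iff dom.awalk_Cons_iff vertex_in edge_in intro!: cod.gis_mult_closed)

lemma source_mult_path_value: "dom.awalk u p v \<Longrightarrow> \<phi>0 u \<cdot> path_value u p = path_value u p"
  by (cases p) (auto simp: dom.awalk_Nil_iff dom.awalk_Cons_iff vertex_idem tail_mult
      simp flip: gis_mult_assoc)

text \<open>The innermost pair of edge values collapses to a vertex value, which the remaining path
  absorbs on its left.\<close>

lemma star_path_value_mult: "dom.awalk u p v \<Longrightarrow> gis_star (path_value u p) \<cdot> path_value u p = \<phi>0 v"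
proof (induction p arbitrary: u)
  case Nil
  then show ?case by (auto simp: dom.awalk_Nil_iff vertex_star vertex_idem)
next
  case (Cons e p)
  let ?W = "path_value (head E e) p"
  have e: "e \<in> arcs E" and p: "dom.awalk (head E e) p v"
    using Cons.prems by (auto simp: dom.awalk_Cons_iff)
  have "gis_star (path_value u (e # p)) \<cdot> path_value u (e # p)
      = gis_star ?W \<cdot> ((gis_star (\<phi>1 e) \<cdot> \<phi>1 e) \<cdot> ?W)"
    by (simp add: gis_star_mult gis_mult_assoc)
  then show ?case
    using Cons.IH[OF p] by (simp add: edge_star_mult[OF e] source_mult_path_value[OF p])
qed

lemma path_value_append:
  "dom.awalk u p v \<Longrightarrow> dom.awalk v q w \<Longrightarrow> path_value u (p @ q) = path_value u p \<cdot> path_value v q"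
  by (induction p arbitrary: u)
     (auto simp: dom.awalk_Nil_iff dom.awalk_Cons_iff source_mult_path_value gis_mult_assoc)

lemma path_value_orth_source:
  assumes "dom.awalk u p v" "dom.awalk u' q w" "u \<noteq> u'"
  shows "gis_star (path_value u p) \<cdot> path_value u' q = None"
proof -
  have "gis_star (path_value u p) \<cdot> path_value u' q
      = gis_star (\<phi>0 u \<cdot> path_value u p) \<cdot> (\<phi>0 u' \<cdot> path_value u' q)"
    using assms by (simp add: source_mult_path_value)
  also have "\<dots> = gis_star (path_value u p) \<cdot> (\<phi>0 u \<cdot> \<phi>0 u') \<cdot> path_value u' q"
    using assms by (simp add: gis_star_mult gis_mult_assoc vertex_star dom.awalk_hd_in_verts)
  finally show ?thesis
    using assms vertex_orth by (simp add: dom.awalk_hd_in_verts)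
qed

text \<open>The induction strips common first edges until two different edges meet in the middle.
  Incomparability rules out that either list runs out before that.\<close>

lemma path_value_orth:
  assumes "dom.awalk u p v" "dom.awalk u q w" "\<not> prefix p q" "\<not> prefix q p"
  shows "gis_star (path_value u p) \<cdot> path_value u q = None"
  using assms
proof (induction p arbitrary: u q)
  case (Cons e p)
  then obtain e' q' where q: "q = e' # q'" by (cases q) auto
  let ?W = "path_value (head E e) p"
  have e: "e \<in> arcs E" "e' \<in> arcs E" and p: "dom.awalk (head E e) p v" "dom.awalk (head E e') q' w"
    using Cons.prems by (auto simp: q dom.awalk_Cons_iff)
  have "gis_star (path_value u (e # p)) \<cdot> path_value u q
      = gis_star ?W \<cdot> ((gis_star (\<phi>1 e) \<cdot> \<phi>1 e') \<cdot> path_value (head E e') q')"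
    by (simp add: q gis_star_mult gis_mult_assoc)
  also have "\<dots> = None"
  proof (cases "e = e'")
    case True
    then show ?thesis
      using Cons.IH[of "head E e" q'] Cons.prems p e
      by (simp add: q edge_star_mult source_mult_path_value)
  qed (simp add: edge_orth e)
  finally show ?case .
qed simp

text \<open>Only the middle product of an adjoint path value and a path value has to be computed;
  its cases are the prefix comparisons in \<open>gis_mult\<close>.\<close>

lemma hom_mult:
  assumes "s \<in> gis E" "t \<in> gis E" shows "hom (s \<cdot> t) = hom s \<cdot> hom t"
proof (cases "s = None \<or> t = None")
  case True
  then show ?thesis by auto
next
  case False
  then obtain a p b q c r d u where st: "s = Some ((a, p), (b, q))" "t = Some ((c, r), (d, u))"
    by auto
  obtain v w where walks: "dom.awalk a p v" "dom.awalk b q v" "dom.awalk c r w" "dom.awalk d u w"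
    using assms by (auto simp: st dom.gis_Some_iff)
  have rhs: "hom s \<cdot> hom t = path_value a p \<cdot> ((gis_star (path_value b q) \<cdot> path_value c r) \<cdot> gis_star (path_value d u))"
    by (simp add: st gis_mult_assoc)
  \<comment> \<open>\<open>right\<close> excludes \<open>q = r\<close>, matching the order of the
    tests in \<open>gis_mult\<close>; unequal sources form a fourth case.\<close>
  consider (left) z where "b = c" "r = q @ z" | (right) z where "b = c" "q = r @ z" "\<not> prefix q r"
    | (orth) "b = c" "\<not> prefix q r" "\<not> prefix r q" | (source) "b \<noteq> c"
    unfolding prefix_def by blast
  then show ?thesis
  proof cases
    case left
    have z: "dom.awalk v z w"
      using walks left by (auto intro: dom.awalk_append_right)
    have "gis_star (path_value b q) \<cdot> path_value c r = \<phi>0 v \<cdot> path_value v z"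
      using walks(2) z left by (simp add: path_value_append star_path_value_mult flip: gis_mult_assoc)
    then show ?thesis
      unfolding rhs using left walks(1) z
      by (simp add: st source_mult_path_value path_value_append gis_mult_assoc)
  next
    case right
    have z: "dom.awalk w z v"
      using walks right by (auto intro: dom.awalk_append_right)
    have "gis_star (path_value b q) \<cdot> path_value c r = gis_star (path_value w z) \<cdot> (gis_star (path_value c r) \<cdot> path_value c r)"
      using walks(3) z right by (simp add: path_value_append gis_star_mult gis_mult_assoc)
    also have "\<dots> = gis_star (\<phi>0 w \<cdot> path_value w z)"
      using walks(3) z by (simp add: star_path_value_mult gis_star_mult vertex_star dom.awalk_hd_in_verts[OF z])
    also have "\<dots> = gis_star (path_value w z)"
      using z by (simp add: source_mult_path_value)
    finally show ?thesis
      unfolding rhs using right walks(4) z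
      by (simp add: st path_value_append gis_star_mult gis_mult_assoc)
  next
    case orth
    then show ?thesis
      unfolding rhs using walks by (simp add: st path_value_orth)
  next
    case source
    then show ?thesis
      unfolding rhs using walks by (simp add: st path_value_orth_source)
  qed
qed

lemma extended_path_hom_hom: "extended_path_hom E F hom"
  unfolding extended_path_hom_def
proof (intro conjI ballI)
  fix s assume s: "s \<in> gis E"
  show "hom s \<in> gis F"
  proof (cases s)
    case (Some x)
    then show ?thesis
      using s by (cases x) (auto simp: dom.gis_Some_iff
        intro!: cod.gis_mult_closed cod.gis_star_closed path_value_closed)
  qed (simp add: cod.gis_None)
qed (simp_all add: hom_mult)

text \<open>This is \<open>s s\<^sup>* s = s\<close> with \<open>edge_star_mult\<close>
  inserted.\<close>

lemma edge_mult_head: "e \<in> arcs E \<Longrightarrow> \<phi>1 e \<cdot> \<phi>0 (head E e) = \<phi>1 e"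
  using gis_mult_star_mult[of "\<phi>1 e"] by (simp add: gis_mult_assoc edge_star_mult)

lemma hom_vertex: "v \<in> verts E \<Longrightarrow> hom (Some (vpath v, vpath v)) = \<phi>0 v"
  by (simp add: vpath_def vertex_star vertex_idem)

lemma hom_edge: "e \<in> arcs E \<Longrightarrow> hom (Some (epath E e, vpath (head E e))) = \<phi>1 e"
  by (simp add: vpath_def epath_def vertex_star edge_mult_head)

lemma hom_edge_edge: "e \<in> arcs E \<Longrightarrow> hom (Some (epath E e, epath E e)) = \<phi>1 e \<cdot> gis_star (\<phi>1 e)"
  by (simp add: epath_def edge_mult_head)

lemma hom_unique:
  assumes \<psi>: "extended_path_hom E F \<psi>" "has_generator_values E \<phi>0 \<phi>1 \<psi>" and s: "s \<in> gis E"
  shows "\<psi> s = hom s"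
proof (cases s)
  case None
  then show ?thesis using \<psi>(1) by (simp add: extended_path_hom_def)
next
  case (Some x)
  then obtain a p b q where s_eq: "s = Some ((a, p), (b, q))" by (cases x) auto
  obtain v where walks: "dom.awalk a p v" "dom.awalk b q v"
    using s by (auto simp: s_eq dom.gis_Some_iff)
  have mult: "\<psi> (s \<cdot> t) = \<psi> s \<cdot> \<psi> t" if "s \<in> gis E" "t \<in> gis E" for s t
    using \<psi>(1) that by (simp add: extended_path_hom_def)
  have star: "\<psi> (gis_star t) = gis_star (\<psi> t)" if "t \<in> gis E" for t
  proof (rule gis_inverse_unique)
    have ts: "gis_star t \<in> gis E" using that by (rule dom.gis_star_closed)
    show "\<psi> t \<cdot> \<psi> (gis_star t) \<cdot> \<psi> t = \<psi> t"
      using that ts by (simp add: gis_mult_star_mult dom.gis_mult_closed flip: mult)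
    show "\<psi> (gis_star t) \<cdot> \<psi> t \<cdot> \<psi> (gis_star t) = \<psi> (gis_star t)"
      using that ts gis_mult_star_mult[of "gis_star t"]
      by (simp add: dom.gis_mult_closed flip: mult)
  qed
  have val: "\<psi> (Some ((u, r), (v, []))) = path_value u r" if "dom.awalk u r v" for u r
    using that
  proof (induction r arbitrary: u)
    case Nil
    then show ?case
      using \<psi>(2) by (auto simp: has_generator_values_def vpath_def dom.awalk_Nil_iff)
  next
    case (Cons e r)
    have e: "e \<in> arcs E" "tail E e = u" and r: "dom.awalk (head E e) r v"
      using Cons.prems by (auto simp: dom.awalk_Cons_iff)
    \<comment> \<open>An element whose second path is a vertex factors into edges, so
      \<open>has_generator_values\<close> determines \<open>\<psi>\<close> on it.\<close>
    have "Some ((u, e # r), (v, [])) = Some (epath E e, vpath (head E e)) \<cdot> Some ((head E e, r), (v, []))"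
      using e by (simp add: epath_def vpath_def)
    moreover have "Some (epath E e, vpath (head E e)) \<in> gis E" "Some ((head E e, r), (v, [])) \<in> gis E"
      using e r dom.awalk_last_in_verts[OF r]
      by (auto simp: dom.gis_Some_iff epath_def vpath_def dom.awalk_Nil_iff dom.awalk_Cons_iff)
    ultimately show ?case
      using \<psi>(2) e Cons.IH[OF r] by (simp add: mult has_generator_values_def)
  qed
  \<comment> \<open>A general element splits at the common target \<open>v\<close> into two such
    elements, one of them inverted.\<close>
  have "s = Some ((a, p), (v, [])) \<cdot> gis_star (Some ((b, q), (v, [])))"
    by (simp add: s_eq)
  moreover have "Some ((a, p), (v, [])) \<in> gis E" "Some ((b, q), (v, [])) \<in> gis E"
    using walks dom.awalk_last_in_verts[OF walks(1)]
    by (auto simp: dom.gis_Some_iff dom.awalk_Nil_iff)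
  ultimately have "\<psi> s = \<psi> (Some ((a, p), (v, []))) \<cdot> gis_star (\<psi> (Some ((b, q), (v, []))))"
    by (metis mult star dom.gis_star_closed)
  then show ?thesis
    using walks by (simp add: val s_eq)
qed

theorem yields_hom: "yields E F \<phi>0 \<phi>1 hom"
  unfolding yields_def
proof (intro conjI allI impI ballI)
  show "has_generator_values E \<phi>0 \<phi>1 hom"
    unfolding has_generator_values_def using hom_vertex hom_edge by blast
qed (auto intro: hom_unique extended_path_hom_hom)

end

section \<open>Relations in graph C*-algebras\<close>

abbreviation vgen :: "'v \<Rightarrow> ('v + 'e) free_alg" where "vgen v \<equiv> free_gen (Inl v)"

abbreviation egen :: "'e \<Rightarrow> ('v + 'e) free_alg" where "egen e \<equiv> free_gen (Inr e)"

text \<open>Stated for an arbitrary seminorm killing the relators because it is instantiated twice: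
  with every such \<open>p\<close>, to bound the generators, and then with the universal norm, which
  is known to be a C*-seminorm only after that bound.\<close>

locale graph_cstar_seminorm =
  wf_digraph G + free_cstar_seminorm "graph_gens G" p
  for G :: "('v, 'e) pre_digraph" and p :: "('v + 'e) free_alg \<Rightarrow> real" +
  assumes relator_null: "r \<in> graph_relators G \<Longrightarrow> p r = 0"
begin

notation null_eq (infix "\<approx>" 50)

lemma vgen_in [simp]: "v \<in> verts G \<Longrightarrow> vgen v \<in> free_carrier (graph_gens G)"
  and egen_in [simp]: "e \<in> arcs G \<Longrightarrow> egen e \<in> free_carrier (graph_gens G)"
  by (simp_all add: free_carrier_gen graph_gens_def)

lemma relator_null_eq:
  assumes "x - y \<in> graph_relators G" "x \<in> free_carrier (graph_gens G)" "y \<in> free_carrier (graph_gens G)"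
  shows "x \<approx> y"
  using relator_null[OF assms(1)] assms(2,3) by (simp add: null_eq_def)

lemma null_eq_mult_left: "x \<approx> y \<Longrightarrow> z \<in> free_carrier (graph_gens G) \<Longrightarrow> z * x \<approx> z * y"
  by (intro null_eq_mult null_eq_refl)

lemma null_eq_mult_right: "x \<approx> y \<Longrightarrow> z \<in> free_carrier (graph_gens G) \<Longrightarrow> x * z \<approx> y * z"
  by (intro null_eq_mult null_eq_refl)

lemma vgen_adj: "v \<in> verts G \<Longrightarrow> free_adj (vgen v) \<approx> vgen v"
  by (rule relator_null_eq) (auto simp: graph_relators_def Let_def free_carrier_adj)

lemma vgen_idem: "v \<in> verts G \<Longrightarrow> vgen v * vgen v \<approx> vgen v"
  by (rule relator_null_eq) (auto simp: graph_relators_def Let_def free_carrier_mult)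

lemma vgen_orth: "u \<in> verts G \<Longrightarrow> v \<in> verts G \<Longrightarrow> u \<noteq> v \<Longrightarrow> vgen u * vgen v \<approx> 0"
  by (rule relator_null_eq) (auto simp: graph_relators_def Let_def free_carrier_mult)

lemma adj_egen_mult: "e \<in> arcs G \<Longrightarrow> free_adj (egen e) * egen e \<approx> vgen (head G e)"
  by (rule relator_null_eq) (auto simp: graph_relators_def Let_def free_carrier_mult free_carrier_adj)

lemma adj_egen_mult_orth:
  "e \<in> arcs G \<Longrightarrow> e' \<in> arcs G \<Longrightarrow> e \<noteq> e' \<Longrightarrow> free_adj (egen e) * egen e' \<approx> 0"
  by (rule relator_null_eq) (auto simp: graph_relators_def Let_def free_carrier_mult free_carrier_adj)

lemma tail_mult_egen: "e \<in> arcs G \<Longrightarrow> vgen (tail G e) * egen e \<approx> egen e"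
  by (rule relator_null_eq) (auto simp: graph_relators_def Let_def free_carrier_mult)

lemma vgen_eq_sum:
  assumes "v \<in> reg G"
  shows "vgen v \<approx> (\<Sum>e\<in>out_arcs G v. egen e * free_adj (egen e))"
proof (rule relator_null_eq)
  show "vgen v - (\<Sum>e\<in>out_arcs G v. egen e * free_adj (egen e)) \<in> graph_relators G"
    unfolding graph_relators_def Let_def by (rule UnI2) (use assms in blast)
  show "vgen v \<in> free_carrier (graph_gens G)"
    using assms by (simp add: reg_def)
  show "(\<Sum>e\<in>out_arcs G v. egen e * free_adj (egen e)) \<in> free_carrier (graph_gens G)"
    by (intro free_carrier_sum free_carrier_mult free_carrier_adj) simp_all
qed

lemma null_eq_seminorm_eq: "x \<approx> y \<Longrightarrow> p x = p y"
  using abs_diff_le[of x y] by (simp add: null_eq_def)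

text \<open>The C*-identity applied to \<open>S\<^sub>e P - S\<^sub>e\<close> for the target projection \<open>P\<close>.\<close>

lemma egen_mult_head:
  assumes e: "e \<in> arcs G" shows "egen e * vgen (head G e) \<approx> egen e"
proof -
  let ?S = "egen e" and ?P = "vgen (head G e)"
  let ?A = "free_adj ?S * ?S" and ?x = "?S * ?P - ?S"
  have P: "head G e \<in> verts G" using e by simp
  note in_carrier = free_carrier_intros vgen_in[OF P] egen_in[OF e]
  have "free_adj ?x * ?x = free_adj ?P * ?A * ?P - free_adj ?P * ?A - (?A * ?P - ?A)"
    by (simp add: free_adj_diff free_adj_mult algebra_simps)
  also have "\<dots> \<approx> ?P * ?P * ?P - ?P * ?P - (?P * ?P - ?P)"
    by (intro null_eq_diff null_eq_mult vgen_adj adj_egen_mult P e null_eq_refl in_carrier)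
  also have "\<dots> \<approx> ?P * ?P - ?P - (?P - ?P)"
    by (intro null_eq_diff null_eq_mult vgen_idem P null_eq_refl in_carrier)
  also have "\<dots> \<approx> ?P - ?P - (?P - ?P)"
    by (intro null_eq_diff null_eq_mult vgen_idem P null_eq_refl in_carrier)
  finally have "(p ?x)\<^sup>2 = 0"
    using cstar[of ?x] null_eq_seminorm_eq[of "free_adj ?x * ?x" 0] by (simp add: in_carrier)
  then show ?thesis by (simp add: null_eq_def in_carrier)
qed

text \<open>By the C*-identity a vertex projection satisfies \<open>(p P)^2 = p P\<close>, and an
  edge satisfies \<open>(p S)^2 = p P\<close> for its target projection \<open>P\<close>.\<close>

lemma gen_le_one:
  assumes "g \<in> graph_gens G" shows "p (free_gen g) \<le> 1"
proof -
  \<comment> \<open>\<open>max a 1\<close> covers both uses: squares equal to \<open>a\<close> for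
    vertices and squares at most 1 for edges.\<close>
  have le_one: "a \<le> 1" if "a\<^sup>2 \<le> max a 1" for a :: real
    using that by (smt (verit) max_def power2_eq_square mult_less_cancel_left1 mult_le_cancel_left1)
  have vertex: "p (vgen v) \<le> 1" if v: "v \<in> verts G" for v
  proof -
    have "free_adj (vgen v) * vgen v \<approx> vgen v * vgen v"
      by (intro null_eq_mult_right vgen_adj vgen_in v)
    also have "\<dots> \<approx> vgen v" by (rule vgen_idem[OF v])
    finally have "(p (vgen v))\<^sup>2 = p (vgen v)"
      using null_eq_seminorm_eq cstar[of "vgen v"] v by simp
    then show ?thesis by (intro le_one) simp
  qed
  have "p (egen e) \<le> 1" if e: "e \<in> arcs G" for e
    using null_eq_seminorm_eq[OF adj_egen_mult[OF e]] cstar[of "egen e"] e vertex[of "head G e"]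
    by (intro le_one) simp
  then show ?thesis using assms vertex by (auto simp: graph_gens_def)
qed

text \<open>The summation relation with a single summand: the form in which the hypothesis on the
  edges leaving \<open>w\<close> enters the C*-computations.\<close>

lemma egen_mult_adj:
  assumes "v \<in> verts G" "out_arcs G v = {g}"
  shows "egen g * free_adj (egen g) \<approx> vgen v"
  using vgen_eq_sum[of v] assms by (auto simp: reg_def intro: null_eq_sym)

text \<open>
  The elements \<open>S\<^sub>e S\<^sub>g S\<^sub>g\<^sub>'\<^sup>*\<close> below model the images of the edges into \<open>w\<close>, with \<open>g\<close> and \<open>g'\<close> two copies
  of \<open>f\<close>. They have the range projection of \<open>S\<^sub>e\<close>, but the source projection \<open>S\<^sub>g\<^sub>' S\<^sub>g\<^sub>'\<^sup>*\<close>.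
\<close>

lemma adj_return_mult:
  assumes arcs: "e \<in> arcs G" "g \<in> arcs G" "g' \<in> arcs G" and adjacent: "head G e = tail G g" "head G g = head G g'"
  shows "free_adj (egen e * egen g * free_adj (egen g')) * (egen e * egen g * free_adj (egen g'))
    \<approx> egen g' * free_adj (egen g')" (is "?lhs \<approx> _")
proof -
  note in_carrier = free_carrier_intros arcs[THEN egen_in]
  have "?lhs = egen g' * (free_adj (egen g) * (free_adj (egen e) * egen e * egen g)) * free_adj (egen g')"
    by (simp add: free_adj_mult mult.assoc)
  also have "\<dots> \<approx> egen g' * (free_adj (egen g) * (vgen (tail G g) * egen g)) * free_adj (egen g')"
    using adj_egen_mult[OF arcs(1)] unfolding adjacent(1)
    by (intro null_eq_mult_left null_eq_mult_right in_carrier)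
  also have "\<dots> \<approx> egen g' * (free_adj (egen g) * egen g) * free_adj (egen g')"
    by (intro null_eq_mult_left null_eq_mult_right in_carrier tail_mult_egen arcs)
  also have "\<dots> \<approx> egen g' * vgen (head G g') * free_adj (egen g')"
    using adj_egen_mult[OF arcs(2)] unfolding adjacent(2)
    by (intro null_eq_mult_left null_eq_mult_right in_carrier)
  also have "\<dots> \<approx> egen g' * free_adj (egen g')"
    by (intro null_eq_mult_right in_carrier egen_mult_head arcs)
  finally show ?thesis .
qed

text \<open>The inner factors collapse to \<open>egen g * free_adj (egen g)\<close>. It is
  \<open>out\<close> that makes this the whole projection of \<open>head G e\<close>, which
  \<open>egen e\<close> then absorbs.\<close>

lemma return_mult_adj:
  assumes arcs: "e \<in> arcs G" "g \<in> arcs G" "g' \<in> arcs G" and heads: "head G g = head G g'"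
    and out: "out_arcs G (head G e) = {g}"
  shows "egen e * egen g * free_adj (egen g') * free_adj (egen e * egen g * free_adj (egen g'))
    \<approx> egen e * free_adj (egen e)" (is "?lhs \<approx> _")
proof -
  note in_carrier = free_carrier_intros arcs[THEN egen_in]
  have "?lhs = egen e * (egen g * (free_adj (egen g') * egen g') * free_adj (egen g)) * free_adj (egen e)"
    by (simp add: free_adj_mult mult.assoc)
  also have "\<dots> \<approx> egen e * (egen g * vgen (head G g) * free_adj (egen g)) * free_adj (egen e)"
    using adj_egen_mult[OF arcs(3)] unfolding heads[symmetric]
    by (intro null_eq_mult_left null_eq_mult_right in_carrier)
  also have "\<dots> \<approx> egen e * (egen g * free_adj (egen g)) * free_adj (egen e)"
    by (intro null_eq_mult_left null_eq_mult_right in_carrier egen_mult_head arcs)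
  also have "\<dots> \<approx> egen e * vgen (head G e) * free_adj (egen e)"
    by (intro null_eq_mult_left null_eq_mult_right in_carrier egen_mult_adj out) (simp add: arcs)
  also have "\<dots> \<approx> egen e * free_adj (egen e)"
    by (intro null_eq_mult_right in_carrier egen_mult_head arcs)
  finally show ?thesis .
qed

end

section \<open>The graph C*-algebra as a universal C*-algebra\<close>

locale graph_algebra = wf_digraph G for G :: "('v, 'e) pre_digraph"

sublocale graph_algebra \<subseteq> bounded_presentation "graph_gens G" "graph_relators G"
proof (rule bounded_presentationI)
  fix p g assume *: "cstar_seminorm (graph_gens G) p" "\<And>r. r \<in> graph_relators G \<Longrightarrow> p r = 0"
    "g \<in> graph_gens G"
  interpret graph_cstar_seminorm G p
    by unfold_locales (use * in auto)
  show "p (free_gen g) \<le> 1" by (rule gen_le_one) fact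
qed

sublocale graph_algebra \<subseteq> graph_cstar_seminorm G "universal_norm (graph_gens G) (graph_relators G)"
  by unfold_locales (rule universal_norm_rel)

context graph_algebra
begin

lemma S_vertex_cls: "S_vertex G v = cls (\<lambda>_. vgen v)"
  and S_edge_cls: "S_edge G e = cls (\<lambda>_. egen e)"
  by (simp_all add: S_vertex_def S_edge_def universal_gen_def)

lemma cmult_cls_const:
  assumes "x \<in> free_carrier (graph_gens G)" "y \<in> free_carrier (graph_gens G)"
  shows "cmult (graph_cstar G) (cls (\<lambda>_. x)) (cls (\<lambda>_. y)) = cls (\<lambda>_. x * y)"
  using cmult_cls[OF cauchy_seqs_const cauchy_seqs_const, OF assms] by (simp add: graph_cstar_def)

lemma cadj_cls_const:
  "x \<in> free_carrier (graph_gens G) \<Longrightarrow> cadj (graph_cstar G) (cls (\<lambda>_. x)) = cls (\<lambda>_. free_adj x)"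
  using cadj_cls[OF cauchy_seqs_const, of x] by (simp add: graph_cstar_def)

end

section \<open>Balanced in-splits\<close>

lemma block_index_eq:
  assumes "indexed_partition n P A" "j \<in> {1..n}" "x \<in> P j"
  shows "block_index n P x = j"
  unfolding block_index_def
proof (rule the_equality)
  fix i assume "i \<in> {1..n} \<and> x \<in> P i"
  then show "i = j"
    using assms disjoint_family_onD[of P "{1..n}" i j] by (auto simp: indexed_partition_def)
qed (use assms in simp)

lemma block_index_in:
  assumes "indexed_partition n P A" "x \<in> A"
  shows "block_index n P x \<in> {1..n}"
proof -
  obtain j where "j \<in> {1..n}" "x \<in> P j"
    using assms by (auto simp: indexed_partition_def)
  then show ?thesis using block_index_eq[OF assms(1)] by simp
qed

lemma in_split_simps [simp]:
  "tail (in_split E w n P) (e, i) = (tail E e, i)"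
  "head (in_split E w n P) (e, i) =
     (if head E e \<noteq> w then (head E e, 1) else (w, block_index n P e))"
  "(v, i) \<in> verts (in_split E w n P) \<longleftrightarrow> v \<in> verts E \<and> v \<noteq> w \<and> i = 1 \<or> v = w \<and> i \<in> {1..n}"
  "(e, i) \<in> arcs (in_split E w n P) \<longleftrightarrow>
     e \<in> arcs E \<and> (tail E e \<noteq> w \<and> i = 1 \<or> tail E e = w \<and> i \<in> {1..n})"
  by (auto simp: in_split_def)

text \<open>The partition enters an in-split only through \<open>head\<close>. Both in-splits
  therefore share generators, regular vertices and outgoing edges.\<close>

lemma in_split_cong:
  "verts (in_split E w n P) = verts (in_split E w n Q)"
  "arcs (in_split E w n P) = arcs (in_split E w n Q)"
  "out_arcs (in_split E w n P) = out_arcs (in_split E w n Q)"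
  "reg (in_split E w n P) = reg (in_split E w n Q)"
  "graph_gens (in_split E w n P) = graph_gens (in_split E w n Q)"
  by (simp_all add: in_split_def out_arcs_def reg_def graph_gens_def fun_eq_iff)

lemma (in wf_digraph) wf_digraph_in_split:
  assumes "indexed_partition n P (in_arcs G w)"
  shows "wf_digraph (in_split G w n P)"
proof
  fix x assume x: "x \<in> arcs (in_split G w n P)"
  obtain e i where e: "x = (e, i)" by (cases x)
  show "tail (in_split G w n P) x \<in> verts (in_split G w n P)"
    using x by (auto simp: e)
  show "head (in_split G w n P) x \<in> verts (in_split G w n P)"
    using x block_index_in[OF assms, of e] by (auto simp: e in_arcs_def)
qed

text \<open>Paths with different first edges are incomparable. Every value \<open>\<phi>1 x\<close>
  below has a left path beginning with \<open>x\<close> itself, so this yields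
  \<open>edge_orth\<close>.\<close>

lemma gis_star_mult_orth:
  "x \<noteq> y \<Longrightarrow> gis_star (Some ((u, x # p), \<beta>)) \<cdot> Some ((v, y # q), \<delta>) = None"
  by (cases \<beta>; cases \<delta>) simp

section \<open>The extended path homomorphism of a balanced in-split\<close>

locale balanced_split = wf_digraph E
  for E :: "('v, 'e) pre_digraph" +
  fixes w :: 'v and f :: 'e and n :: nat and L R :: "nat \<Rightarrow> 'e set"
  assumes out_w: "out_arcs E w = {f}"
    and partition_L: "indexed_partition n L (in_arcs E w)"
    and partition_R: "indexed_partition n R (in_arcs E w)"
begin

abbreviation EL where "EL \<equiv> in_split E w n L"
abbreviation ER where "ER \<equiv> in_split E w n R"

sublocale EL: graph_algebra EL
  unfolding graph_algebra_def by (rule wf_digraph_in_split) (rule partition_L)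

sublocale ER: graph_algebra ER
  unfolding graph_algebra_def by (rule wf_digraph_in_split) (rule partition_R)

lemma f_arc: "f \<in> arcs E" "tail E f = w"
  using out_w by (auto simp: out_arcs_def)

lemma tail_eq_w: "e \<in> arcs E \<Longrightarrow> tail E e = w \<Longrightarrow> e = f"
  using out_w by (auto simp: out_arcs_def)

lemma block_index_L: "e \<in> arcs E \<Longrightarrow> head E e = w \<Longrightarrow> 1 \<le> block_index n L e \<and> block_index n L e \<le> n"
  and block_index_R: "e \<in> arcs E \<Longrightarrow> head E e = w \<Longrightarrow> 1 \<le> block_index n R e \<and> block_index n R e \<le> n"
  using block_index_in[OF partition_L, of e] block_index_in[OF partition_R, of e]
  by (simp_all add: in_arcs_def)

lemma out_arcs_ER_w: "i \<in> {1..n} \<Longrightarrow> out_arcs ER (w, i) = {(f, i)}"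
  by (auto simp: out_arcs_def f_arc dest: tail_eq_w)

abbreviation "\<phi>0 \<equiv> split_vertex_map w f ER"
abbreviation "\<phi>1 \<equiv> split_edge_map E w f n L R ER"

lemma split_maps_simps:
  "v \<noteq> w \<Longrightarrow> \<phi>0 (v, i) = Some (((v, i), []), ((v, i), []))"
  "\<phi>0 (w, i) = Some (((w, i), [(f, i)]), ((w, i), [(f, i)]))"
  "head E e \<noteq> w \<Longrightarrow> \<phi>1 (e, i) = Some (((tail E e, i), [(e, i)]), ((head E e, 1), []))"
  "head E e = w \<Longrightarrow> \<phi>1 (e, i) =
     Some (((tail E e, i), [(e, i), (f, block_index n R e)]),
       ((w, block_index n L e), [(f, block_index n L e)]))"
  by (simp_all add: split_vertex_map_def split_edge_map_def vpath_def epath_def concat_path_def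
      f_arc Let_def)

sublocale path_hom_generators EL ER \<phi>0 \<phi>1
proof
  fix v assume "v \<in> verts EL"
  moreover obtain u i where v: "v = (u, i)" by (cases v)
  ultimately show "\<phi>0 v \<in> gis ER"
    \<comment> \<open>The index of \<open>f\<close> matters when \<open>f\<close> is a loop at
      \<open>w\<close>: the target of every copy of \<open>f\<close> is then the copy of
      \<open>w\<close> with that index.\<close>
    using f_arc block_index_R[of f]
    by (cases "u = w") (auto simp: split_maps_simps ER.gis_Some_iff ER.awalk_Cons_iff ER.awalk_Nil_iff)
  show "gis_star (\<phi>0 v) = \<phi>0 v"
    by (cases "u = w") (simp_all add: v split_maps_simps)
next
  fix u v :: "'v \<times> nat" assume "u \<noteq> v"
  moreover obtain u' i v' j where "u = (u', i)" "v = (v', j)" by (cases u; cases v)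
  ultimately show "\<phi>0 u \<cdot> \<phi>0 v = None"
    by (cases "u' = w"; cases "v' = w") (auto simp: split_maps_simps)
next
  fix x assume x: "x \<in> arcs EL"
  obtain e i where e: "x = (e, i)" by (cases x)
  show "\<phi>1 x \<in> gis ER"
    using x f_arc block_index_R[of e] block_index_L[of e] block_index_R[of f]
    by (cases "head E e = w")
       (auto simp: e split_maps_simps ER.gis_Some_iff ER.awalk_Cons_iff ER.awalk_Nil_iff)
  show "gis_star (\<phi>1 x) \<cdot> \<phi>1 x = \<phi>0 (head EL x)"
    by (cases "head E e = w") (simp_all add: e split_maps_simps)
  show "\<phi>0 (tail EL x) \<cdot> \<phi>1 x = \<phi>1 x"
    \<comment> \<open>An edge leaving \<open>w\<close> is a copy of \<open>f\<close>, so its value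
      begins with \<open>(f, i)\<close> and absorbs \<open>\<phi>0 (w, i)\<close> on the
      left.\<close>
    using x tail_eq_w[of e]
    by (cases "head E e = w"; cases "tail E e = w") (auto simp: e split_maps_simps)
next
  fix x y :: "'e \<times> nat" assume "x \<noteq> y"
  moreover have "\<exists>u p \<beta>. \<phi>1 x = Some ((u, x # p), \<beta>)" for x
  proof (cases x)
    case (Pair e i)
    show ?thesis by (cases "head E e = w") (simp_all add: Pair split_maps_simps)
  qed
  ultimately show "gis_star (\<phi>1 x) \<cdot> \<phi>1 y = None"
    by (metis gis_star_mult_orth)
qed

text \<open>For an edge into \<open>w\<close> this lies strictly below the projection of the edge
  alone; the regularity proof has to bridge that gap.\<close>

lemma edge_range_projection:
  "\<phi>1 (e, i) \<cdot> gis_star (\<phi>1 (e, i)) =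
     (let \<alpha> = ((tail E e, i), if head E e = w then [(e, i), (f, block_index n R e)] else [(e, i)])
      in Some (\<alpha>, \<alpha>))"
  by (cases "head E e = w") (simp_all add: split_maps_simps Let_def)

lemma regular_hom_hom: "regular_hom EL ER hom"
  unfolding regular_hom_def
proof (intro ballI impI)
  fix u t assume u: "u \<in> reg EL" and t: "t \<in> gis ER" "t \<noteq> None \<and> gis_le t (hom (Some (vpath u, vpath u)))"
  have u_vert: "u \<in> verts EL" using u by (simp add: reg_def)
  obtain a p b q where t_eq: "t = Some ((a, p), (b, q))" using t by auto
  obtain p' where u_proj: "\<phi>0 u = Some ((u, p'), (u, p'))"
    by (cases u; cases "fst u = w") (auto simp: split_maps_simps)
  have le: "Some ((a, p), (a, p)) \<cdot> Some ((u, p'), (u, p')) = t"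
    using t(2) unfolding hom_vertex[OF u_vert] u_proj by (simp add: gis_le_def t_eq)
  \<comment> \<open>A product of two projections is a projection, so \<open>t\<close> is given by
    one path \<open>p\<close> starting at \<open>u\<close>.\<close>
  have a: "a = u" "b = u" "q = p"
    using le by (auto simp: t_eq prefix_def split: if_splits)
  obtain v where walk: "ER.awalk u p v"
    using t(1) by (auto simp: t_eq a ER.gis_Some_iff)
  have "\<exists>x\<in>out_arcs EL u. t \<cdot> (\<phi>1 x \<cdot> gis_star (\<phi>1 x)) \<noteq> None"
  proof (cases p)
    case Nil
    \<comment> \<open>Here \<open>t\<close> is the projection of \<open>u\<close>, which annihilates
      no outgoing edge; regularity of \<open>u\<close> provides one.\<close>
    obtain x where x_out: "x \<in> out_arcs EL u" using u unfolding reg_def by blast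
    obtain e i where x: "x = (e, i)" by (cases x)
    have u_eq: "u = (tail E e, i)" using x_out by (simp add: x out_arcs_def)
    have "t \<cdot> (\<phi>1 x \<cdot> gis_star (\<phi>1 x)) \<noteq> None"
      using Nil by (simp add: t_eq a x u_eq edge_range_projection Let_def)
    with x_out show ?thesis ..
  next
    case (Cons x r)
    obtain e i where x: "x = (e, i)" by (cases x)
    have x_arc: "x \<in> arcs ER" "tail ER x = u" and r: "ER.awalk (head ER x) r v"
      using walk by (auto simp: Cons ER.awalk_Cons_iff)
    \<comment> \<open>This makes \<open>p\<close> comparable with the longer path in
      \<open>edge_range_projection\<close>, so the product cannot vanish.\<close>
    have r_eq: "r = [] \<or> (\<exists>r'. r = (f, block_index n R e) # r')" if e: "head E e = w"
    proof (cases r)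
      case (Cons y r')
      have "y \<in> out_arcs ER (w, block_index n R e)"
        using r e by (auto simp: Cons x ER.awalk_Cons_iff)
      moreover have "block_index n R e \<in> {1..n}"
        using block_index_R[of e] x_arc(1) e by (simp add: x)
      ultimately have "y = (f, block_index n R e)"
        using out_arcs_ER_w by blast
      then show ?thesis by (simp add: Cons)
    qed simp
    have u_eq: "u = (tail E e, i)" using x_arc(2) by (simp add: x)
    \<comment> \<open>The first edge of \<open>p\<close>, a path in \<open>ER\<close>, is also an
      edge of \<open>EL\<close>, since arcs and tails agree.\<close>
    have "x \<in> out_arcs EL u"
      using x_arc(1) by (simp add: x u_eq out_arcs_def)
    moreover have "t \<cdot> (\<phi>1 x \<cdot> gis_star (\<phi>1 x)) \<noteq> None"
    proof (cases "head E e = w")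
      case True
      from r_eq[OF True] show ?thesis
        by (elim disjE exE) (simp_all add: t_eq a Cons x u_eq edge_range_projection Let_def True)
    qed (simp add: t_eq a Cons x u_eq edge_range_projection Let_def)
    ultimately show ?thesis ..
  qed
  then obtain x where x: "t \<cdot> (\<phi>1 x \<cdot> gis_star (\<phi>1 x)) \<noteq> None" "x \<in> out_arcs EL u" ..
  then have "x \<in> arcs EL" by (simp add: out_arcs_def)
  then have "t \<cdot> hom (Some (epath EL x, epath EL x)) \<noteq> None"
    by (subst hom_edge_edge) (use x(1) in simp_all)
  then show "\<exists>x\<in>out_arcs EL u. t \<cdot> hom (Some (epath EL x, epath EL x)) \<noteq> None"
    using x(2) ..
qed

section \<open>The induced map on the C*-level\<close>

definition gen_image :: "('v \<times> nat) + ('e \<times> nat) \<Rightarrow> (('v \<times> nat) + ('e \<times> nat)) free_alg" where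
  "gen_image = case_sum vgen (\<lambda>(e, i). if head E e \<noteq> w then egen (e, i)
     else egen (e, i) * egen (f, block_index n R e) * free_adj (egen (f, block_index n L e)))"

lemma gen_image_simps [simp]:
  "gen_image (Inl v) = vgen v"
  "head E e \<noteq> w \<Longrightarrow> gen_image (Inr (e, i)) = egen (e, i)"
  "head E e = w \<Longrightarrow> gen_image (Inr (e, i)) =
     egen (e, i) * egen (f, block_index n R e) * free_adj (egen (f, block_index n L e))"
  by (simp_all add: gen_image_def)

notation ER.null_eq (infix "\<approx>" 50)

lemma f_arc_ER: "e \<in> arcs E \<Longrightarrow> head E e = w \<Longrightarrow> (f, block_index n R e) \<in> arcs ER"
  "e \<in> arcs E \<Longrightarrow> head E e = w \<Longrightarrow> (f, block_index n L e) \<in> arcs ER"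
  using f_arc block_index_L[of e] block_index_R[of e] by simp_all

lemma arc_ELD: "(e, i) \<in> arcs EL \<Longrightarrow> e \<in> arcs E \<and> (e, i) \<in> arcs ER"
  by simp

lemma gen_image_in: "g \<in> graph_gens EL \<Longrightarrow> gen_image g \<in> free_carrier (graph_gens ER)"
proof -
  have edge: "gen_image (Inr x) \<in> free_carrier (graph_gens ER)" if "x \<in> arcs EL" for x
  proof -
    obtain e i where x: "x = (e, i)" by (cases x)
    have e: "e \<in> arcs E" "(e, i) \<in> arcs ER" using that arc_ELD by (auto simp: x)
    show ?thesis
      using e f_arc_ER[OF e(1)]
      by (cases "head E e = w")
         (simp_all add: x free_carrier_mult free_carrier_adj del: in_split_simps)
  qed
  assume "g \<in> graph_gens EL"
  then consider v where "v \<in> verts EL" "g = Inl v" | x where "x \<in> arcs EL" "g = Inr x"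
    unfolding graph_gens_def by blast
  then show ?thesis
  proof cases
    case 1
    then have "v \<in> verts ER" using in_split_cong(1)[of E w n L R] by simp
    then show ?thesis by (simp add: 1)
  qed (simp add: edge)
qed

lemma adj_gen_image_mult:
  assumes "x \<in> arcs EL"
  shows "free_adj (gen_image (Inr x)) * gen_image (Inr x) \<approx> vgen (head EL x)"
proof -
  obtain e i where x: "x = (e, i)" by (cases x)
  have e: "e \<in> arcs E" "(e, i) \<in> arcs ER" using assms arc_ELD by (auto simp: x)
  show ?thesis
  proof (cases "head E e = w")
    case True
    let ?j = "block_index n L e" and ?k = "block_index n R e"
    have j: "?j \<in> {1..n}" using block_index_L[OF e(1) True] by simp
    have "free_adj (gen_image (Inr x)) * gen_image (Inr x) \<approx> egen (f, ?j) * free_adj (egen (f, ?j))"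
      unfolding x gen_image_simps(3)[OF True]
      by (rule ER.adj_return_mult[OF e(2) f_arc_ER[OF e(1) True]]) (simp_all add: True f_arc)
    \<comment> \<open>The range projection of the copy of \<open>f\<close> at index
      \<open>?j\<close> fills the projection of its source, which is the target of \<open>x\<close>
      in \<open>EL\<close>.\<close>
    also have "\<dots> \<approx> vgen (w, ?j)"
      by (rule ER.egen_mult_adj) (use j in \<open>simp_all add: out_arcs_ER_w\<close>)
    finally show ?thesis by (simp add: x True)
  next
    case False
    then show ?thesis using ER.adj_egen_mult[OF e(2)] by (simp add: x)
  qed
qed

text \<open>Since range projections are unchanged and \<open>out_arcs\<close> agree, the summation
  relations of \<open>EL\<close> reduce to those of \<open>ER\<close>.\<close>

lemma gen_image_mult_adj:
  assumes "x \<in> arcs EL"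
  shows "gen_image (Inr x) * free_adj (gen_image (Inr x)) \<approx> egen x * free_adj (egen x)"
proof -
  obtain e i where x: "x = (e, i)" by (cases x)
  have e: "e \<in> arcs E" "(e, i) \<in> arcs ER" using assms arc_ELD by (auto simp: x)
  show ?thesis
  proof (cases "head E e = w")
    case True
    have "out_arcs ER (head ER (e, i)) = {(f, block_index n R e)}"
      using block_index_R[OF e(1) True] by (simp add: True out_arcs_ER_w)
    then show ?thesis
      unfolding x gen_image_simps(3)[OF True]
      by (intro ER.return_mult_adj e f_arc_ER True) simp
  next
    case False
    have "egen x * free_adj (egen x) \<in> free_carrier (graph_gens ER)"
      using e by (simp add: x free_carrier_mult free_carrier_adj del: in_split_simps)
    then show ?thesis using False by (simp add: x ER.null_eq_refl)
  qed
qed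

text \<open>Tail and orthogonality relations concern only the left factor \<open>egen x\<close>, so
  this shape transfers them. The second alternative is separate because \<open>y = 1\<close> is not
  in the carrier.\<close>

lemma gen_image_factor:
  assumes "x \<in> arcs EL"
  obtains y where "y \<in> free_carrier (graph_gens ER)" "gen_image (Inr x) = egen x * y"
    | "gen_image (Inr x) = egen x"
proof -
  obtain e i where x: "x = (e, i)" by (cases x)
  have e: "e \<in> arcs E" using assms by (simp add: x)
  show thesis
  proof (cases "head E e = w")
    case True
    show thesis
    proof (rule that(1))
      show "egen (f, block_index n R e) * free_adj (egen (f, block_index n L e)) \<in> free_carrier (graph_gens ER)"
        using f_arc_ER[OF e True] by (simp add: free_carrier_mult free_carrier_adj del: in_split_simps)
    qed (simp add: x True mult.assoc)
  qed (use that(2) x in simp)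
qed

lemma tail_mult_gen_image:
  assumes "x \<in> arcs EL"
  shows "vgen (tail EL x) * gen_image (Inr x) \<approx> gen_image (Inr x)"
proof -
  have x: "x \<in> arcs ER" "tail EL x = tail ER x"
    using assms by (cases x; simp)+
  have *: "vgen (tail EL x) * egen x \<approx> egen x"
    using ER.tail_mult_egen[OF x(1)] by (simp add: x)
  from assms show ?thesis
  proof (cases rule: gen_image_factor)
    case (1 y)
    then show ?thesis using ER.null_eq_mult_right[OF *] by (simp add: mult.assoc)
  qed (use * in simp)
qed

lemma adj_gen_image_mult_orth:
  assumes "x \<in> arcs EL" "x' \<in> arcs EL" "x \<noteq> x'"
  shows "free_adj (gen_image (Inr x)) * gen_image (Inr x') \<approx> 0"
proof -
  have arcs: "x \<in> arcs ER" "x' \<in> arcs ER"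
    using assms in_split_cong(2)[of E w n L R] by auto
  have *: "free_adj (egen x) * egen x' \<approx> 0"
    by (rule ER.adj_egen_mult_orth) (use arcs assms in auto)
  have **: "free_adj (egen x) * gen_image (Inr x') \<approx> 0"
    using assms(2)
  proof (cases rule: gen_image_factor)
    case (1 y)
    then show ?thesis using ER.null_eq_mult_right[OF *, of y] by (simp add: mult.assoc)
  qed (use * in simp)
  from assms(1) show ?thesis
  proof (cases rule: gen_image_factor)
    case (1 y)
    then show ?thesis
      using ER.null_eq_mult_left[OF **, of "free_adj y"]
      by (simp add: free_adj_mult mult.assoc free_carrier_adj)
  qed (use ** in simp)
qed

lemma vgen_eq_sum_gen_image:
  assumes "v \<in> reg EL"
  shows "vgen v \<approx> (\<Sum>x\<in>out_arcs EL v. gen_image (Inr x) * free_adj (gen_image (Inr x)))"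
proof -
  have "v \<in> reg ER" using assms in_split_cong(4)[of E w n L R] by simp
  then have "vgen v \<approx> (\<Sum>x\<in>out_arcs ER v. egen x * free_adj (egen x))"
    by (rule ER.vgen_eq_sum)
  also have "out_arcs ER v = out_arcs EL v"
    by (simp add: in_split_cong(3)[of E w n R L])
  also have "(\<Sum>x\<in>out_arcs EL v. egen x * free_adj (egen x))
      \<approx> (\<Sum>x\<in>out_arcs EL v. gen_image (Inr x) * free_adj (gen_image (Inr x)))"
    by (intro ER.null_eq_sum ER.null_eq_sym[OF gen_image_mult_adj]) simp
  finally show ?thesis .
qed

sublocale presentation_map "graph_gens EL" "graph_relators EL" "graph_gens ER" "graph_relators ER" gen_image
proof
  fix r assume r: "r \<in> graph_relators EL"
  have verts: "verts EL = verts ER" by (rule in_split_cong)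
  have null: "ER.U (x - y) = 0" if "x \<approx> y" for x y
    using that by (simp add: ER.null_eq_def)
  note simps = free_extend_diff free_extend_mult free_extend_adj free_extend_sum
  \<comment> \<open>The facts 1 to 7 match the seven families in \<open>graph_relators\<close>, in
    order.\<close>
  have 1: "ER.U (free_adj (vgen v) - vgen v) = 0" if "v \<in> verts EL" for v
    using that by (intro null ER.vgen_adj) (simp add: verts)
  have 2: "ER.U (vgen v * vgen v - vgen v) = 0" if "v \<in> verts EL" for v
    using that by (intro null ER.vgen_idem) (simp add: verts)
  have 3: "ER.U (vgen u * vgen v) = 0" if "u \<in> verts EL" "v \<in> verts EL" "u \<noteq> v" for u v
    using null[OF ER.vgen_orth[of u v]] that by (simp add: verts)
  have 4: "ER.U (free_adj (gen_image (Inr x)) * gen_image (Inr x) - vgen (head EL x)) = 0"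
    if "x \<in> arcs EL" for x
    using that by (intro null adj_gen_image_mult)
  have 5: "ER.U (free_adj (gen_image (Inr x)) * gen_image (Inr x')) = 0"
    if "x \<in> arcs EL" "x' \<in> arcs EL" "x \<noteq> x'" for x x'
    using null[OF adj_gen_image_mult_orth[OF that]] by simp
  have 6: "ER.U (vgen (tail EL x) * gen_image (Inr x) - gen_image (Inr x)) = 0" if "x \<in> arcs EL" for x
    using that by (intro null tail_mult_gen_image)
  have 7: "ER.U (vgen v - (\<Sum>x\<in>out_arcs EL v. gen_image (Inr x) * free_adj (gen_image (Inr x)))) = 0"
    if "v \<in> reg EL" for v
    using that by (intro null vgen_eq_sum_gen_image)
  show "ER.U (free_extend gen_image r) = 0"
    using r[unfolded graph_relators_def Let_def]
    by (elim UnE CollectE exE conjE; hypsubst)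
       (simp_all only: simps free_extend_gen gen_image_simps(1) 1 2 3 4 5 6 7 not_False_eq_True)
qed (rule gen_image_in)

section \<open>Compatibility with the semigroup homomorphism\<close>

lemma induced_vertex: "v \<in> verts EL \<Longrightarrow> induced (S_vertex EL v) = S_vertex ER v"
  using induced_universal_gen[of "Inl v"]
  by (simp add: S_vertex_def[of EL] ER.S_vertex_cls graph_gens_def)

lemma induced_edge: "x \<in> arcs EL \<Longrightarrow> induced (S_edge EL x) = ER.cls (\<lambda>_. gen_image (Inr x))"
  using induced_universal_gen[of "Inr x"]
  by (simp add: S_edge_def[of EL] graph_gens_def)

lemma induced_edge_return:
  assumes "(e, i) \<in> arcs EL" "head E e = w"
  shows "induced (S_edge EL (e, i)) =
    cmult (graph_cstar ER)
      (cmult (graph_cstar ER) (S_edge ER (e, i)) (S_edge ER (f, block_index n R e)))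
      (cadj (graph_cstar ER) (S_edge ER (f, block_index n L e)))"
proof -
  have e: "e \<in> arcs E" "(e, i) \<in> arcs ER" using assms(1) arc_ELD by auto
  show ?thesis
    using e(2) f_arc_ER[OF e(1) assms(2)]
    by (simp add: induced_edge assms ER.S_edge_cls ER.cmult_cls_const ER.cadj_cls_const
        free_carrier_mult free_carrier_adj del: in_split_simps)
qed

text \<open>\<open>S_gis\<close> gives a projection times its adjoint away from \<open>w\<close>,
  and the range projection of a copy of \<open>f\<close> at \<open>w\<close>; the summation relation
  returns the vertex projection in the latter case.\<close>

lemma S_gis_vertex:
  assumes "v \<in> verts EL" shows "S_gis ER (\<phi>0 v) = S_vertex ER v"
proof -
  obtain u i where v: "v = (u, i)" by (cases v)
  have v_in: "v \<in> verts ER" using assms by (simp add: v)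
  show ?thesis
  proof (cases "u = w")
    case True
    then have i: "i \<in> {1..n}" using assms by (simp add: v)
    have f_in: "(f, i) \<in> arcs ER" using i f_arc by simp
    have "S_gis ER (\<phi>0 v) = ER.cls (\<lambda>_. egen (f, i) * free_adj (egen (f, i)))"
      using f_in by (simp add: v True split_maps_simps ER.S_edge_cls ER.cmult_cls_const
          ER.cadj_cls_const free_carrier_adj del: in_split_simps)
    also have "\<dots> = S_vertex ER v"
      unfolding ER.S_vertex_cls using v_in out_arcs_ER_w[OF i]
      by (intro ER.cls_const_eqI ER.egen_mult_adj) (simp_all add: v True)
    finally show ?thesis .
  next
    case False
    have "vgen v * free_adj (vgen v) \<approx> vgen v * vgen v"
      by (intro ER.null_eq_mult_left ER.vgen_adj ER.vgen_in v_in)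
    also have "\<dots> \<approx> vgen v" by (rule ER.vgen_idem[OF v_in])
    finally have "ER.cls (\<lambda>_. vgen v * free_adj (vgen v)) = S_vertex ER v"
      unfolding ER.S_vertex_cls by (rule ER.cls_const_eqI)
    then show ?thesis
      using False v_in by (simp add: v split_maps_simps ER.S_vertex_cls ER.cmult_cls_const
          ER.cadj_cls_const free_carrier_adj del: in_split_simps)
  qed
qed

text \<open>For an edge into \<open>w\<close> both sides are the same product. Otherwise
  \<open>S_gis\<close> carries an extra adjoint of the target projection, absorbed by
  \<open>egen_mult_head\<close>.\<close>

lemma S_gis_edge:
  assumes "x \<in> arcs EL" shows "S_gis ER (\<phi>1 x) = induced (S_edge EL x)"
proof -
  obtain e i where x: "x = (e, i)" by (cases x)
  have e: "e \<in> arcs E" "x \<in> arcs ER" using assms arc_ELD by (auto simp: x)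
  show ?thesis
  proof (cases "head E e = w")
    case True
    then show ?thesis
      using assms by (simp add: x split_maps_simps induced_edge_return del: in_split_simps(3,4))
  next
    case False
    let ?h = "head ER x"
    have h: "?h \<in> verts ER" using e(2) by (rule ER.head_in_verts)
    have "egen x * free_adj (vgen ?h) \<approx> egen x * vgen ?h"
      by (intro ER.null_eq_mult_left ER.vgen_adj ER.egen_in h e)
    also have "\<dots> \<approx> egen x" by (rule ER.egen_mult_head[OF e(2)])
    finally have "ER.cls (\<lambda>_. egen x * free_adj (vgen ?h)) = ER.cls (\<lambda>_. egen x)"
      by (rule ER.cls_const_eqI)
    moreover have "S_gis ER (\<phi>1 x) = cmult (graph_cstar ER) (S_edge ER x) (cadj (graph_cstar ER) (S_vertex ER ?h))"
      using False by (simp add: x split_maps_simps)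
    ultimately show ?thesis
      using assms e h False gen_image_simps(2)[OF False]
      by (simp add: induced_edge x ER.S_edge_cls ER.S_vertex_cls ER.cmult_cls_const ER.cadj_cls_const
          free_carrier_adj del: in_split_simps)
  qed
qed

lemma induces_induced: "induces EL ER hom induced"
  unfolding induces_def
  using star_hom_induced
  by (simp add: graph_cstar_def hom_vertex hom_edge S_gis_vertex S_gis_edge induced_vertex)

end

theorem theorem5p29:
  fixes E :: "('v, 'e) pre_digraph" and w :: 'v and f :: 'e
    and n :: nat and L R :: "nat \<Rightarrow> 'e set"
    and EL ER :: "('v \<times> nat, 'e \<times> nat) pre_digraph"
  assumes "wf_digraph E"
    and "w \<in> verts E"
    and "out_arcs E w = {f}"
    and "balanced_in_split E w n L R EL ER"
  shows "\<exists>\<phi>. yields EL ER (split_vertex_map w f ER) (split_edge_map E w f n L R ER) \<phi> \<and>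
    regular_hom EL ER \<phi> \<and>
    (\<exists>\<Phi>. induces EL ER \<phi> \<Phi> \<and>
      (\<forall>v i. (v, i) \<in> verts EL \<longrightarrow> \<Phi> (S_vertex EL (v, i)) = S_vertex ER (v, i)) \<and>
      (\<forall>e i. (e, i) \<in> arcs EL \<longrightarrow> head E e \<noteq> w \<longrightarrow>
        \<Phi> (S_edge EL (e, i)) = S_edge ER (e, i)) \<and>
      (\<forall>e i j k. (e, i) \<in> arcs EL \<longrightarrow> head E e = w \<longrightarrow>
        j \<in> {1..n} \<longrightarrow> k \<in> {1..n} \<longrightarrow> e \<in> L j \<inter> R k \<longrightarrow>
        \<Phi> (S_edge EL (e, i)) =
          cmult (graph_cstar ER)
            (cmult (graph_cstar ER) (S_edge ER (e, i)) (S_edge ER (f, k)))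
            (cadj (graph_cstar ER) (S_edge ER (f, j)))))"
proof -
  have split: "indexed_partition n L (in_arcs E w)" "indexed_partition n R (in_arcs E w)"
    "EL = in_split E w n L" "ER = in_split E w n R"
    using assms(4) by (simp_all add: balanced_in_split_def)
  interpret wf_digraph E by fact
  interpret balanced_split E w f n L R
    by unfold_locales (fact assms(3) split)+
  show ?thesis
    unfolding split(3,4)
  proof (intro exI[of _ hom] exI[of _ induced] conjI allI impI)
    show "induced (S_edge (in_split E w n L) (e, i)) = S_edge (in_split E w n R) (e, i)"
      if "(e, i) \<in> arcs (in_split E w n L)" "head E e \<noteq> w" for e i
      using that by (simp add: induced_edge ER.S_edge_cls del: in_split_simps)
    show "induced (S_edge (in_split E w n L) (e, i)) =
        cmult (graph_cstar (in_split E w n R))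
          (cmult (graph_cstar (in_split E w n R)) (S_edge (in_split E w n R) (e, i))
            (S_edge (in_split E w n R) (f, k)))
          (cadj (graph_cstar (in_split E w n R)) (S_edge (in_split E w n R) (f, j)))"
      if "(e, i) \<in> arcs (in_split E w n L)" "head E e = w" "j \<in> {1..n}" "k \<in> {1..n}" "e \<in> L j \<inter> R k"
      for e i j k
      \<comment> \<open>Disjointness of the blocks identifies \<open>j\<close> and \<open>k\<close>,
        given by membership, with the block indices in \<open>gen_image\<close>.\<close>
      using induced_edge_return[OF that(1,2)] that(5)
        block_index_eq[OF split(1) that(3)] block_index_eq[OF split(2) that(4)] by simp
  qed (fact yields_hom regular_hom_hom induces_induced | erule induced_vertex)+
qed

end
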